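(* Let $\mu\in\mathbb{R}^n$, $\sigma>0$, $\xi\sim\mathcal{N}(0,\sigma^2I_{n\times n})$ and $y=\mu+\xi$. Then for all $x>0$, with probability at least $1-e^{-x}$, $$\|\hat\mu^{LS}(\mathcal{U})-\mu\|\le\min_{u\in\mathcal{U}}\left[\|u-\mu\|+\frac{2\sigma}{\sqrt n}\left(\sqrt{(k(u)+1)\log\left(\tfrac{en}{k(u)+1}\right)}+\sqrt{2(x+\log n)}\right)\right].$$
   Context: Scaled norm: $\|v\|^2=\frac1n\sum_{i=1}^n v_i^2$ for $v\in\mathbb{R}^n$. $\mathcal{U}=\bigcup_{m=1}^nK_m$ is the set of unimodal sequences in $\mathbb{R}^n$, where $K_m=\{u\in\mathbb{R}^n: u_1\ge\dots\ge u_m\le u_{m+1}\le\dots\le u_n\}$. For $u\in\mathcal{U}$, $k(u)$ is the smallest integer $k$ such that there is a partition of $\{1,\dots,n\}$ into $k$ sets of consecutive integers on each of which $u$ is constant. The least squares estimator over a nonempty closed (possibly non-convex) set $K$ is any $\hat\mu^{LS}(K)\in\operatorname{argmin}_{v\in K}\|y-v\|^2$. *)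

theory Defs
  imports "HOL-Probability.Probability" "HOL-Library.Disjoint_Sets"
begin

text \<open>A vector of \<open>\<real>\<^sup>n\<close> is a function \<^typ>\<open>nat \<Rightarrow> real\<close> read on the indices \<open>{1..n}\<close>.  Every notion
  below depends on these coordinates only, so the values elsewhere are immaterial.\<close>

definition scaled_norm :: "nat \<Rightarrow> (nat \<Rightarrow> real) \<Rightarrow> real" where
  "scaled_norm n v = sqrt (1 / real n * (\<Sum>i=1..n. (v i)\<^sup>2))"

definition unimodal_cone :: "nat \<Rightarrow> nat \<Rightarrow> (nat \<Rightarrow> real) set" where
  "unimodal_cone n m = {u. antimono_on {1..m} u \<and> mono_on {m..n} u}"

definition unimodal :: "nat \<Rightarrow> (nat \<Rightarrow> real) set" where
  "unimodal n = (\<Union>m\<in>{1..n}. unimodal_cone n m)"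

definition num_pieces :: "nat \<Rightarrow> (nat \<Rightarrow> real) \<Rightarrow> nat" where
  "num_pieces n u = (LEAST k. \<exists>P. partition_on {1..n} P \<and> card P = k \<and>
     (\<forall>I\<in>P. (\<exists>a b. I = {a..b}) \<and> (\<forall>i\<in>I. \<forall>j\<in>I. u i = u j)))"

text \<open>The minimiser need not be unique, hence a predicate on \<open>v\<close>.\<close>

definition is_least_squares ::
    "nat \<Rightarrow> (nat \<Rightarrow> real) set \<Rightarrow> (nat \<Rightarrow> real) \<Rightarrow> (nat \<Rightarrow> real) \<Rightarrow> bool" where
  "is_least_squares n K y v \<longleftrightarrow>
     is_arg_min (\<lambda>v. (scaled_norm n (\<lambda>i. y i - v i))\<^sup>2) (\<lambda>v. v \<in> K) v"

end

theory Submission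
  imports Defs
begin

text \<open>
  Fix \<open>u\<close>. If the estimator \<open>v\<close> lies in the cone with mode \<open>m\<close>, then \<open>v - u\<close> is monotone on each of at
  most \<open>k(u) + 1\<close> intervals: the pieces of \<open>u\<close>, one of them cut at \<open>m\<close>. The basic inequality of least
  squares therefore reduces the claim, by a union bound over \<open>m\<close>, to a deviation bound for the norm of
  the projection of \<open>\<xi>\<close> onto a product of monotone cones.

  On one interval of length \<open>n\<close> (with \<open>\<sigma> = 1\<close>) the squared norm of the projection is the sum of
  \<open>(block sum)\<^sup>2 / (block length)\<close> over the blocks of the greatest convex minorant of the partial sums.
  Deleting one block from the minorant leaves a minorant, and a new block fits in exactly one place
  almost surely; by the cycle lemma a Gaussian block of length \<open>b\<close> is admissible with probability
  \<open>1 / b\<close>, independently of its sum. This gives the recursion \<open>n A\<^sub>n \<le> s (A\<^sub>0 + \<dots> + A\<^sub>n\<^sub>-\<^sub>1)\<close> for the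
  exponential moment \<open>A\<^sub>n\<close> with exponent \<open>(1 - s\<^sup>-\<^sup>2) / 2\<close>, hence \<open>A\<^sub>n \<le> exp ((s - 1) (1 + ln n))\<close>.
  A Chernoff bound with the optimal \<open>s\<close> then yields exactly the stated deviation, without any appeal to
  Gaussian concentration for Lipschitz functions.

  For \<open>k(u) = n\<close> the quantity \<open>(n + 1) ln (e n / (n + 1))\<close> is slightly smaller than \<open>n\<close>; there the
  \<open>ln n\<close> gained by not needing the union bound makes up for the difference if \<open>n \<ge> 2\<close>, and the factor \<open>2\<close>
  does so if \<open>n = 1\<close>. The infimum over \<open>u\<close> is reached by taking the limes superior of the events belonging
  to a minimising sequence.
\<close>


subsection \<open>Tight block decompositions\<close>

definition block_sum :: "(nat \<Rightarrow> real) \<Rightarrow> nat \<Rightarrow> nat \<Rightarrow> real" where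
  "block_sum f p b = (\<Sum>i<b. f (p + i))"

text \<open>Geometrically, the partial sums stay strictly above the chord joining the two ends of
  the block. Strictness is what leaves at most one tight cyclic shift.\<close>

definition tight_block :: "(nat \<Rightarrow> real) \<Rightarrow> nat \<Rightarrow> nat \<Rightarrow> bool" where
  "tight_block f p b \<longleftrightarrow> (\<forall>j\<in>{0<..<b}. block_sum f p b / real b < block_sum f p j / real j)"

fun block_means :: "(nat \<Rightarrow> real) \<Rightarrow> nat \<Rightarrow> nat list \<Rightarrow> real list" where
  "block_means f p [] = []"
| "block_means f p (b # c) = block_sum f p b / real b # block_means f (p + b) c"

fun tight_blocks :: "(nat \<Rightarrow> real) \<Rightarrow> nat \<Rightarrow> nat list \<Rightarrow> bool" where
  "tight_blocks f p [] \<longleftrightarrow> True"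
| "tight_blocks f p (b # c) \<longleftrightarrow> tight_block f p b \<and> tight_blocks f (p + b) c"

text \<open>For a tight decomposition with increasing means this is the squared norm of the
  projection of \<open>f\<close> onto the increasing vectors, the projection being constant on each
  block and equal to the block mean.\<close>

fun energy :: "(nat \<Rightarrow> real) \<Rightarrow> nat \<Rightarrow> nat list \<Rightarrow> real" where
  "energy f p [] = 0"
| "energy f p (b # c) = (block_sum f p b)\<^sup>2 / real b + energy f (p + b) c"

definition compositions :: "nat \<Rightarrow> nat list set" where
  "compositions n = {c. sum_list c = n \<and> 0 \<notin> set c}"

lemma block_sum_add: "block_sum f p (a + b) = block_sum f p a + block_sum f (p + a) b"
  unfolding block_sum_def
  by (induction b) (simp_all add: add.assoc)

lemma block_sum_cong:
  assumes "\<And>i. i < b \<Longrightarrow> f (p + i) = g (q + i)"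
  shows "block_sum f p b = block_sum g q b"
  unfolding block_sum_def using assms by (intro sum.cong) auto

lemma tight_block_cong:
  assumes "\<And>i. i < b \<Longrightarrow> f (p + i) = g (q + i)"
  shows "tight_block f p b = tight_block g q b"
proof -
  have "block_sum f p j = block_sum g q j" if "j \<le> b" for j
    using assms that by (intro block_sum_cong) auto
  then show ?thesis
    unfolding tight_block_def by (intro ball_cong) auto
qed

lemma blocks_cong:
  assumes "\<And>i. i < sum_list c \<Longrightarrow> f (p + i) = g (q + i)"
  shows "block_means f p c = block_means g q c"
    and "tight_blocks f p c = tight_blocks g q c"
    and "energy f p c = energy g q c"
proof -
  have "block_means f p c = block_means g q c \<and> tight_blocks f p c = tight_blocks g q c
      \<and> energy f p c = energy g q c"
    using assms
  proof (induction c arbitrary: p q)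
    case (Cons b c)
    have 1: "f (p + i) = g (q + i)" if "i < b" for i
      using Cons.prems[of i] that by simp
    have "f (p + b + i) = g (q + b + i)" if "i < sum_list c" for i
      using Cons.prems[of "b + i"] that by (simp add: add.assoc)
    then show ?case
      using Cons.IH[of "p + b" "q + b"] block_sum_cong[of b f p g q, OF 1]
        tight_block_cong[of b f p g q, OF 1] by auto
  qed simp
  then show "block_means f p c = block_means g q c" "tight_blocks f p c = tight_blocks g q c"
    "energy f p c = energy g q c" by auto
qed

lemma block_means_append:
  "block_means f p (c @ d) = block_means f p c @ block_means f (p + sum_list c) d"
  by (induction c arbitrary: p) (simp_all add: add.assoc)

lemma tight_blocks_append:
  "tight_blocks f p (c @ d) \<longleftrightarrow> tight_blocks f p c \<and> tight_blocks f (p + sum_list c) d"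
  by (induction c arbitrary: p) (simp_all add: add.assoc)

lemma energy_append:
  "energy f p (c @ d) = energy f p c + energy f (p + sum_list c) d"
  by (induction c arbitrary: p) (simp_all add: add.assoc)

lemma length_block_means [simp]: "length (block_means f p c) = length c"
  by (induction c arbitrary: p) auto

lemma energy_nonneg: "0 \<le> energy f p c"
  by (induction c arbitrary: p) auto

lemma length_le_sum_list:
  assumes "0 \<notin> set c" shows "length c \<le> sum_list (c :: nat list)"
  using assms by (induction c) auto

lemma finite_compositions: "finite (compositions n)"
proof (rule finite_subset)
  show "compositions n \<subseteq> {c. set c \<subseteq> {..n} \<and> length c \<le> n}"
    using length_le_sum_list member_le_sum_list by (fastforce simp: compositions_def)
  show "finite {c. set c \<subseteq> {..n} \<and> length c \<le> n}"
    by (rule finite_lists_length_le) simp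
qed

lemma compositions_0 [simp]: "compositions 0 = {[]}"
proof -
  have "c = []" if "sum_list c = 0" "0 \<notin> set c" for c :: "nat list"
    using that by (cases c) auto
  then show ?thesis by (auto simp: compositions_def)
qed

text \<open>The first block is the shortest initial segment of minimal mean (the first edge of the
  greatest convex minorant of the partial sums).\<close>

lemma ex_sorted_tight_composition:
  "\<exists>c\<in>compositions n. sorted (block_means f p c) \<and> tight_blocks f p c"
proof (induction n arbitrary: p rule: less_induct)
  case (less n)
  show ?case
  proof (cases "n = 0")
    case False
    define mean where "mean j = block_sum f p j / real j" for j
    define m where "m = Min (mean ` {1..n})"
    have fin: "finite (mean ` {1..n})" "mean ` {1..n} \<noteq> {}"
      using False by auto
    have m_le: "m \<le> mean j" if "j \<in> {1..n}" for j
      unfolding m_def using fin that by auto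
    have "m \<in> mean ` {1..n}"
      unfolding m_def using fin by (rule Min_in)
    then have ex: "\<exists>j. j \<in> {1..n} \<and> mean j = m" by auto
    define b where "b = (LEAST j. j \<in> {1..n} \<and> mean j = m)"
    have b: "b \<in> {1..n}" "mean b = m"
      using LeastI_ex[OF ex] unfolding b_def by auto
    have tight: "tight_block f p b"
      unfolding tight_block_def
    proof
      fix j assume j: "j \<in> {0<..<b}"
      have "mean j \<noteq> m"
        using not_less_Least[of j "\<lambda>j. j \<in> {1..n} \<and> mean j = m"] j b(1)
        unfolding b_def[symmetric] by auto
      with m_le[of j] b j have "mean b < mean j" by auto
      then show "block_sum f p b / real b < block_sum f p j / real j"
        by (simp add: mean_def)
    qed
    obtain c where c: "c \<in> compositions (n - b)" "sorted (block_means f (p + b) c)"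
      "tight_blocks f (p + b) c"
      using less.IH[of "n - b" "p + b"] b(1) False by auto
    \<comment> \<open>A segment of mean below \<open>m\<close> right behind the first block would
      pull the mean of the joint initial segment below the minimum.\<close>
    have first: "m \<le> block_sum f (p + b) j / real j" if "j \<in> {1..n - b}" for j
    proof -
      have "m * real (b + j) \<le> block_sum f p (b + j)"
        using m_le[of "b + j"] that by (auto simp: mean_def field_simps)
      moreover have "m * real b = block_sum f p b"
        using b by (auto simp: mean_def field_simps)
      ultimately show ?thesis
        using that by (auto simp: block_sum_add field_simps)
    qed
    \<comment> \<open>As the remaining means are sorted, only the first of them has to be compared
      with \<open>m\<close>.\<close>
    have "\<forall>y\<in>set (block_means f (p + b) c). m \<le> y"
    proof (cases c)
      case (Cons a d)
      have "a \<in> {1..n - b}"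
        using c(1) Cons by (auto simp: compositions_def)
      from first[OF this] c(2) show ?thesis
        by (auto simp: Cons)
    qed simp
    with c b tight have "b # c \<in> compositions n" "sorted (block_means f p (b # c))"
      "tight_blocks f p (b # c)"
      by (auto simp: compositions_def mean_def)
    then show ?thesis by blast
  qed simp
qed

text \<open>Abel summation. The excess \<open>T\<close> of the partial sums over the chord is
  nonnegative inside the block and vanishes at its end, so the centred block contributes at most
  zero against increasing weights. What is left is the block mean times the sum of the
  weights.\<close>

lemma tight_block_sum_mult_le:
  assumes tight: "tight_block f p b" and mono: "mono_on {p..<p + b} v" and "b > 0"
  shows "(\<Sum>i<b. f (p + i) * v (p + i)) \<le> block_sum f p b / real b * (\<Sum>i<b. v (p + i))"
proof -
  define m where "m = block_sum f p b / real b"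
  define T where "T j = block_sum f p j - real j * m" for j
  have T_nonneg: "0 \<le> T j" if "j < b" for j
  proof (cases "j = 0")
    case False
    then have "m < block_sum f p j / real j"
      using tight that unfolding tight_block_def m_def by simp
    then show ?thesis
      using False by (simp add: T_def field_simps)
  qed (simp add: T_def block_sum_def)
  \<comment> \<open>Only the boundary term of the summation by parts is kept; the dropped terms are
    minus \<open>T\<close> times an increment of \<open>v\<close>, hence at most zero.\<close>
  have "(\<Sum>i<Suc j. (f (p + i) - m) * v (p + i)) \<le> T (Suc j) * v (p + j)" if "j < b" for j
    using that
  proof (induction j)
    case 0
    then show ?case by (simp add: T_def block_sum_def)
  next
    case (Suc j)
    have "T (Suc j) * v (p + j) \<le> T (Suc j) * v (p + Suc j)"
      using Suc.prems T_nonneg by (intro mult_left_mono mono_onD[OF mono]) auto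
    moreover have "T (Suc (Suc j)) = T (Suc j) + (f (p + Suc j) - m)"
      by (simp add: T_def block_sum_def algebra_simps)
    then have "T (Suc (Suc j)) * v (p + Suc j)
        = T (Suc j) * v (p + Suc j) + (f (p + Suc j) - m) * v (p + Suc j)"
      by (simp only: distrib_right)
    ultimately show ?case
      using Suc.IH Suc.prems unfolding sum.lessThan_Suc[of _ "Suc j"] by linarith
  qed
  from this[of "b - 1"] \<open>b > 0\<close> have "(\<Sum>i<b. (f (p + i) - m) * v (p + i)) \<le> T b * v (p + (b - 1))"
    by simp
  moreover have "T b = 0" using \<open>b > 0\<close> by (simp add: T_def m_def)
  ultimately show ?thesis
    by (simp add: m_def[symmetric] left_diff_distrib sum_subtractf sum_distrib_left)
qed

text \<open>Cauchy-Schwarz in the plane, from Lagrange's identity; it glues the estimate for the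
  first block to that for the others.\<close>

lemma sqrt_mult_add_le:
  assumes "a \<ge> 0" "b \<ge> 0" "c \<ge> 0" "d \<ge> 0"
  shows "sqrt a * sqrt b + sqrt c * sqrt d \<le> sqrt (a + c) * sqrt (b + d)"
proof -
  have "(sqrt a * sqrt b + sqrt c * sqrt d)\<^sup>2 + (sqrt a * sqrt d - sqrt c * sqrt b)\<^sup>2
      = ((sqrt a)\<^sup>2 + (sqrt c)\<^sup>2) * ((sqrt b)\<^sup>2 + (sqrt d)\<^sup>2)"
    by (simp add: power2_eq_square algebra_simps)
  also have "\<dots> = (a + c) * (b + d)" using assms by simp
  finally have "(sqrt a * sqrt b + sqrt c * sqrt d)\<^sup>2 \<le> (a + c) * (b + d)"
    using zero_le_power2[of "sqrt a * sqrt d - sqrt c * sqrt b"] by linarith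
  then show ?thesis
    unfolding real_sqrt_mult[symmetric] by (rule real_le_rsqrt)
qed

text \<open>In each block, summation by parts replaces \<open>f\<close> by its mean, and
  Cauchy-Schwarz against the constant vector brings in the block length. In this way the energy
  bounds the inner product of the noise with every increasing vector simultaneously.\<close>

lemma sum_mult_le_sqrt_energy:
  assumes "tight_blocks f p c" "0 \<notin> set c" "mono_on {p..<p + sum_list c} v"
  shows "(\<Sum>i<sum_list c. f (p + i) * v (p + i))
    \<le> sqrt (energy f p c) * sqrt (\<Sum>i<sum_list c. (v (p + i))\<^sup>2)"
  using assms
proof (induction c arbitrary: p)
  case (Cons b c)
  define q where "q = p + b"
  have split: "(\<Sum>i<b + sum_list c. g (p + i)) = (\<Sum>i<b. g (p + i)) + (\<Sum>i<sum_list c. g (q + i))"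
    for g :: "nat \<Rightarrow> real"
    using block_sum_add[of g p b "sum_list c"] by (simp add: block_sum_def q_def)
  have b: "b > 0" using Cons.prems by auto
  have "(\<Sum>i<b. v (p + i))\<^sup>2 \<le> real b * (\<Sum>i<b. (v (p + i))\<^sup>2)"
    using Cauchy_Schwarz_ineq_sum[of "\<lambda>_. 1" "\<lambda>i. v (p + i)" "{..<b}"] by simp
  then have cs: "\<bar>\<Sum>i<b. v (p + i)\<bar> \<le> sqrt (real b) * sqrt (\<Sum>i<b. (v (p + i))\<^sup>2)"
    by (simp add: real_le_rsqrt flip: real_sqrt_mult)
  have "(\<Sum>i<b. f (p + i) * v (p + i)) \<le> block_sum f p b / real b * (\<Sum>i<b. v (p + i))"
    using Cons.prems b by (intro tight_block_sum_mult_le) (auto intro: mono_on_subset)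
  also have "\<dots> \<le> \<bar>block_sum f p b / real b\<bar> * \<bar>\<Sum>i<b. v (p + i)\<bar>"
    using abs_ge_self[of "block_sum f p b / real b * (\<Sum>i<b. v (p + i))"] by (simp add: abs_mult)
  also have "\<dots> \<le> \<bar>block_sum f p b / real b\<bar> * (sqrt (real b) * sqrt (\<Sum>i<b. (v (p + i))\<^sup>2))"
    by (intro mult_left_mono cs) auto
  also have "\<dots> = sqrt ((block_sum f p b)\<^sup>2 / real b) * sqrt (\<Sum>i<b. (v (p + i))\<^sup>2)"
    using b by (simp add: real_sqrt_divide field_simps)
  finally have 1: "(\<Sum>i<b. f (p + i) * v (p + i))
      \<le> sqrt ((block_sum f p b)\<^sup>2 / real b) * sqrt (\<Sum>i<b. (v (p + i))\<^sup>2)" .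
  have "(\<Sum>i<sum_list c. f (q + i) * v (q + i))
      \<le> sqrt (energy f q c) * sqrt (\<Sum>i<sum_list c. (v (q + i))\<^sup>2)"
    using Cons.prems unfolding q_def by (intro Cons.IH) (auto intro: mono_on_subset)
  with 1 sqrt_mult_add_le[of "(block_sum f p b)\<^sup>2 / real b" "\<Sum>i<b. (v (p + i))\<^sup>2"
      "energy f q c" "\<Sum>i<sum_list c. (v (q + i))\<^sup>2"]
  have "(\<Sum>i<b. f (p + i) * v (p + i)) + (\<Sum>i<sum_list c. f (q + i) * v (q + i)) \<le>
    sqrt ((block_sum f p b)\<^sup>2 / real b + energy f q c) *
    sqrt ((\<Sum>i<b. (v (p + i))\<^sup>2) + (\<Sum>i<sum_list c. (v (q + i))\<^sup>2))"
    by (simp add: sum_nonneg energy_nonneg)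
  then show ?case
    using split[of "\<lambda>i. f i * v i"] split[of "\<lambda>i. (v i)\<^sup>2"] by (simp add: q_def)
qed simp

section \<open>Cyclic shifts of a block\<close>

lemma bij_betw_add_mod:
  assumes "q < (b::nat)"
  shows "bij_betw (\<lambda>i. (i + q) mod b) {..<b} {..<b}"
proof -
  have "inj_on (\<lambda>i. (i + q) mod b) {..<b}"
  proof (rule linorder_inj_onI)
    fix x y assume "x < y" "x \<in> {..<b}" "y \<in> {..<b}"
    then have "\<not> b dvd (y + q) - (x + q)"
      by (auto dest: dvd_imp_le)
    then show "(x + q) mod b \<noteq> (y + q) mod b"
      using \<open>x < y\<close> mod_eq_dvd_iff_nat[of "x + q" "y + q" b] by auto
  qed auto
  moreover have "(\<lambda>i. (i + q) mod b) ` {..<b} \<subseteq> {..<b}" using assms by auto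
  ultimately show ?thesis
    by (simp add: bij_betw_def endo_inj_surj)
qed

lemma block_sum_rotate:
  fixes h :: "nat \<Rightarrow> real"
  assumes "q < b"
  shows "block_sum (\<lambda>i. h ((i + q) mod b)) 0 b = block_sum h 0 b"
proof -
  have "(\<Sum>i<b. h ((i + q) mod b)) = (\<Sum>i<b. h i)"
    using bij_betw_add_mod[OF assms] by (rule sum.reindex_bij_betw)
  then show ?thesis by (simp add: block_sum_def)
qed

text \<open>The cycle lemma. If two shifts were tight, the arc between their starting points and the
  complementary arc would be proper initial segments of the two shifts. Both would have mean above
  the overall mean, although together they make up the whole cycle.\<close>

lemma tight_rotation_unique:
  fixes h :: "nat \<Rightarrow> real" and b :: nat
  defines "rot \<equiv> \<lambda>r i. h ((i + r) mod b)"
  assumes "r < r'" "r' < b" and "tight_block (rot r) 0 b" "tight_block (rot r') 0 b"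
  shows False
proof -
  define j where "j = r' - r"
  have full: "block_sum (rot q) 0 b = block_sum h 0 b" if "q < b" for q
    using block_sum_rotate[OF that] by (simp add: rot_def)
  define m where "m = block_sum h 0 b / real b"
  have j: "j \<in> {0<..<b}" "b - j \<in> {0<..<b}" using assms(2,3) unfolding j_def by auto
  have "block_sum (rot r) 0 b / real b < block_sum (rot r) 0 j / real j"
    using assms(4) j(1) unfolding tight_block_def by blast
  then have 1: "m * real j < block_sum (rot r) 0 j"
    using j full[of r] assms(2,3) by (simp add: m_def pos_less_divide_eq)
  have "block_sum (rot r') 0 b / real b < block_sum (rot r') 0 (b - j) / real (b - j)"
    using assms(5) j(2) unfolding tight_block_def by blast
  then have 2: "m * real (b - j) < block_sum (rot r') 0 (b - j)"
    using j full[of r'] assms(2,3) by (simp add: m_def pos_less_divide_eq)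
  \<comment> \<open>Reading from \<open>r'\<close> is reading from \<open>r\<close> with offset
    \<open>j\<close>, so the second initial segment is the rest of the first shift after
    \<open>j\<close> entries.\<close>
  have "i + r' = (j + i) + r" for i
    using assms(2) by (simp add: j_def)
  then have 3: "block_sum (rot r') 0 (b - j) = block_sum (rot r) j (b - j)"
    unfolding block_sum_def rot_def by (simp add: add.assoc add.left_commute)
  have 4: "block_sum (rot r) 0 j + block_sum (rot r) j (b - j) = m * real b"
    using block_sum_add[of "rot r" 0 j "b - j"] j full[of r] assms(2,3) by (simp add: m_def)
  have 5: "m * real j + m * real (b - j) = m * real b"
    using j by (simp add: of_nat_diff flip: distrib_left)
  from 1 2 3 4 5 show False by linarith
qed

subsection \<open>Gaussian weights of decompositions\<close>

definition gauss :: "real measure" where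
  "gauss = density lborel (\<lambda>x. ennreal (std_normal_density x))"

abbreviation gauss_pow :: "nat \<Rightarrow> (nat \<Rightarrow> real) measure" where
  "gauss_pow n \<equiv> PiM {..<n} (\<lambda>_. gauss)"

text \<open>The exponent for which \<open>exp (rate s * Z\<^sup>2)\<close> has expectation
  \<open>s\<close> if \<open>Z\<close> is standard normal; parametrising by this moment lets a block
  contribute a plain factor \<open>s\<close>.\<close>

definition rate :: "real \<Rightarrow> real" where
  "rate s = (1 - 1 / s\<^sup>2) / 2"

text \<open>If \<open>c\<close> has no zero entries, nonzero weight means that the block ends are
  exactly the contact points of the partial sums with their greatest convex minorant. Values in
  \<open>ennreal\<close> allow integration before finiteness is known.\<close>

definition stable_weight :: "real \<Rightarrow> nat list \<Rightarrow> (nat \<Rightarrow> real) \<Rightarrow> ennreal" where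
  "stable_weight s c f = (if sorted (block_means f 0 c) \<and> tight_blocks f 0 c
     then ennreal (exp (rate s * energy f 0 c)) else 0)"

lemma stable_weight_cong:
  "(\<And>i. i < sum_list c \<Longrightarrow> f i = g i) \<Longrightarrow> stable_weight s c f = stable_weight s c g"
  unfolding stable_weight_def using blocks_cong[of c f 0 g 0] by simp

section \<open>Measurability with respect to the Gaussian product measure\<close>

lemma sets_gauss [simp, measurable_cong]: "sets gauss = sets borel"
  by (simp add: gauss_def)

lemma space_gauss [simp]: "space gauss = UNIV"
  by (simp add: gauss_def)

lemma prob_space_gauss: "prob_space gauss"
  unfolding gauss_def by (rule prob_space_normal_density) simp

lemma prob_space_gauss_pow: "prob_space (PiM I (\<lambda>_. gauss))"
  by (intro prob_space_PiM prob_space_gauss)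

lemma measurable_gauss_component:
  "i \<in> I \<Longrightarrow> (\<lambda>f. f i) \<in> borel_measurable (PiM I (\<lambda>_. gauss))"
  using measurable_component_singleton[of i I "\<lambda>_. gauss"]
  by (simp cong: measurable_cong_sets)

lemma measurable_block_sum:
  "p + b \<le> n \<Longrightarrow> (\<lambda>f. block_sum f p b) \<in> borel_measurable (gauss_pow n)"
  unfolding block_sum_def by (intro borel_measurable_sum measurable_gauss_component) auto

lemma measurable_tight_block:
  assumes "p + b \<le> n"
  shows "Measurable.pred (gauss_pow n) (\<lambda>f. tight_block f p b)"
proof -
  have [measurable]: "(\<lambda>f. block_sum f p j) \<in> borel_measurable (gauss_pow n)" if "j \<le> b" for j
    using assms that by (intro measurable_block_sum) auto
  show ?thesis
    unfolding tight_block_def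
    by (intro pred_intros_finite borel_measurable_pred_less) auto
qed

lemma measurable_tight_blocks:
  "p + sum_list c \<le> n \<Longrightarrow> Measurable.pred (gauss_pow n) (\<lambda>f. tight_blocks f p c)"
  by (induction c arbitrary: p) (auto simp: measurable_tight_block intro!: pred_intros_logic)

lemma measurable_energy:
  "p + sum_list c \<le> n \<Longrightarrow> (\<lambda>f. energy f p c) \<in> borel_measurable (gauss_pow n)"
  by (induction c arbitrary: p)
    (auto simp: measurable_block_sum intro!: borel_measurable_add borel_measurable_divide borel_measurable_power)

text \<open>The lower bound \<open>X\<close> is a function because in the sortedness predicate it is
  the mean of the preceding block.\<close>

lemma measurable_le_block_means:
  "p + sum_list c \<le> n \<Longrightarrow> X \<in> borel_measurable (gauss_pow n) \<Longrightarrow>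
    Measurable.pred (gauss_pow n) (\<lambda>f. \<forall>y\<in>set (block_means f p c). X f \<le> y)"
proof (induction c arbitrary: p)
  case (Cons b c)
  have "Measurable.pred (gauss_pow n) (\<lambda>f. X f \<le> block_sum f p b / real b)"
    using Cons.prems unfolding pred_def
    by (intro borel_measurable_le borel_measurable_divide measurable_block_sum) auto
  moreover have "Measurable.pred (gauss_pow n) (\<lambda>f. \<forall>y\<in>set (block_means f (p + b) c). X f \<le> y)"
    using Cons by auto
  ultimately show ?case
    by (auto intro!: pred_intros_logic)
qed simp

lemma measurable_sorted_block_means:
  "p + sum_list c \<le> n \<Longrightarrow> Measurable.pred (gauss_pow n) (\<lambda>f. sorted (block_means f p c))"
  by (induction c arbitrary: p)
    (auto simp: measurable_block_sum
      intro!: pred_intros_logic measurable_le_block_means borel_measurable_divide)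

lemma measurable_stable_weight:
  assumes "sum_list c \<le> n"
  shows "stable_weight s c \<in> borel_measurable (gauss_pow n)"
proof -
  have [measurable]: "Measurable.pred (gauss_pow n) (\<lambda>f. sorted (block_means f 0 c))"
    "Measurable.pred (gauss_pow n) (\<lambda>f. tight_blocks f 0 c)"
    "(\<lambda>f. energy f 0 c) \<in> borel_measurable (gauss_pow n)"
    using assms by (simp_all add: measurable_sorted_block_means measurable_tight_blocks measurable_energy)
  show ?thesis
    unfolding stable_weight_def[abs_def] by measurable
qed

section \<open>Law of a block sum and exponential tilting\<close>

lemma distributed_gauss_component:
  assumes "i < n"
  shows "distributed (gauss_pow n) lborel (\<lambda>f. f i) std_normal_density"
proof -
  have "distr (gauss_pow n) lborel (\<lambda>f. f i) = distr (gauss_pow n) gauss (\<lambda>f. f i)"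
    by (intro distr_cong) auto
  also have "\<dots> = gauss"
    using assms by (intro distr_PiM_component prob_space_gauss) auto
  finally show ?thesis
    using assms measurable_gauss_component[of i "{..<n}"]
    by (simp add: distributed_def gauss_def)
qed

lemma distributed_block_sum:
  assumes "b > 0"
  shows "distributed (gauss_pow b) lborel (\<lambda>f. block_sum f 0 b) (normal_density 0 (sqrt (real b)))"
proof -
  interpret prob_space "gauss_pow b" by (rule prob_space_gauss_pow)
  \<comment> \<open>Points of the product space are extensional, so restricting them is the identity
    there. The joint law of the coordinates is thus the product measure itself, which gives their
    independence.\<close>
  have "distr (gauss_pow b) (Pi\<^sub>M {..<b} (\<lambda>_. borel)) (\<lambda>f. \<lambda>i\<in>{..<b}. f i)
      = distr (gauss_pow b) (gauss_pow b) (\<lambda>f. f)"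
    by (intro distr_cong sets_PiM_cong) (auto simp: space_PiM)
  also have "\<dots> = (\<Pi>\<^sub>M i\<in>{..<b}. distr (gauss_pow b) borel (\<lambda>f. f i))"
    unfolding distr_id
  proof (intro PiM_cong)
    fix i assume "i \<in> {..<b}"
    then have "gauss = distr (gauss_pow b) lborel (\<lambda>f. f i)"
      using distributed_gauss_component[of i b] by (simp add: distributed_def gauss_def)
    then show "gauss = distr (gauss_pow b) borel (\<lambda>f. f i)"
      by (simp cong: distr_cong)
  qed simp
  finally have "indep_vars (\<lambda>_. borel) (\<lambda>i f. f i) {..<b}"
    using assms by (subst indep_vars_iff_distr_eq_PiM') (auto simp: measurable_gauss_component)
  moreover have "{..<b} \<noteq> {}" using assms by auto
  ultimately show ?thesis
    using sum_indep_normal[of "{..<b}" "\<lambda>i f. f i" "\<lambda>_. 1" "\<lambda>_. 0"]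
    by (simp add: block_sum_def distributed_gauss_component)
qed

text \<open>Tilting by \<open>rate s\<close> stretches the standard deviation by the factor
  \<open>s\<close>; the mismatch of the normalising constants leaves the factor \<open>s\<close> as
  total mass.\<close>

lemma exp_rate_mult_normal_density:
  assumes "s > 0" "\<sigma> > 0"
  shows "normal_density 0 \<sigma> x * exp (rate s * (x\<^sup>2 / \<sigma>\<^sup>2)) = s * normal_density 0 (s * \<sigma>) x"
proof -
  have "- x\<^sup>2 / (2 * \<sigma>\<^sup>2) + rate s * (x\<^sup>2 / \<sigma>\<^sup>2) = - x\<^sup>2 / (2 * (s * \<sigma>)\<^sup>2)"
    using assms by (simp add: rate_def field_simps power2_eq_square)
  moreover have "sqrt (2 * pi * (s * \<sigma>)\<^sup>2) = s * sqrt (2 * pi * \<sigma>\<^sup>2)"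
    using assms by (simp add: real_sqrt_mult)
  ultimately show ?thesis
    using assms by (simp add: normal_density_def flip: exp_add)
qed

lemma nn_integral_exp_rate_block_sum:
  assumes "b > 0" "s > 0"
  shows "(\<integral>\<^sup>+f. ennreal (exp (rate s * ((block_sum f 0 b)\<^sup>2 / real b))) \<partial>gauss_pow b) = ennreal s"
proof -
  have "(\<integral>\<^sup>+f. ennreal (exp (rate s * ((block_sum f 0 b)\<^sup>2 / real b))) \<partial>gauss_pow b)
    = (\<integral>\<^sup>+x. ennreal (normal_density 0 (sqrt (real b)) x) * ennreal (exp (rate s * (x\<^sup>2 / real b))) \<partial>lborel)"
    by (rule distributed_nn_integral[symmetric, OF distributed_block_sum[OF assms(1)]]) measurable
  also have "\<dots> = (\<integral>\<^sup>+x. ennreal s * ennreal (normal_density 0 (s * sqrt (real b)) x) \<partial>lborel)"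
    using assms exp_rate_mult_normal_density[of s "sqrt (real b)"]
    by (intro nn_integral_cong) (simp flip: ennreal_mult)
  also have "\<dots> = ennreal s * emeasure (density lborel (normal_density 0 (s * sqrt (real b)))) UNIV"
    by (simp add: nn_integral_cmult emeasure_density)
  also have "\<dots> = ennreal s"
    using prob_space.emeasure_space_1[OF prob_space_normal_density[of "s * sqrt (real b)" 0]] assms
    by simp
  finally show ?thesis .
qed

text \<open>Cyclic shifts preserve the law and the block sum, and at most one of them is tight.\<close>

lemma nn_integral_stable_weight_single:
  assumes "b > 0" "s > 0"
  shows "of_nat b * (\<integral>\<^sup>+f. stable_weight s [b] f \<partial>gauss_pow b) \<le> ennreal s"
proof -
  define rot where "rot r f = (\<lambda>i\<in>{..<b}. f ((i + r) mod b))" for r and f :: "nat \<Rightarrow> real"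
  have rot_eq: "stable_weight s [b] (rot r f) = stable_weight s [b] (\<lambda>i. f ((i + r) mod b))" for r f
    by (rule stable_weight_cong) (simp add: rot_def)
  have inv: "(\<integral>\<^sup>+f. stable_weight s [b] (rot r f) \<partial>gauss_pow b)
      = (\<integral>\<^sup>+f. stable_weight s [b] f \<partial>gauss_pow b)"
    and meas: "(\<lambda>f. stable_weight s [b] (rot r f)) \<in> borel_measurable (gauss_pow b)" if "r < b" for r
  proof -
    have rot_meas: "rot r \<in> measurable (gauss_pow b) (gauss_pow b)"
      unfolding rot_def using assms
      by (intro measurable_restrict measurable_component_singleton) auto
    have "distr (gauss_pow b) (gauss_pow b) (rot r) = gauss_pow b"
      unfolding rot_def using assms bij_betw_add_mod[OF that]
      by (intro distr_PiM_reindex prob_space_gauss) (auto simp: bij_betw_def)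
    then show "(\<integral>\<^sup>+f. stable_weight s [b] (rot r f) \<partial>gauss_pow b)
      = (\<integral>\<^sup>+f. stable_weight s [b] f \<partial>gauss_pow b)"
      using nn_integral_distr[OF rot_meas, of "stable_weight s [b]"] measurable_stable_weight[of "[b]" b]
      by simp
    show "(\<lambda>f. stable_weight s [b] (rot r f)) \<in> borel_measurable (gauss_pow b)"
      using measurable_compose[OF rot_meas measurable_stable_weight[of "[b]" b s]] by simp
  qed
  have le: "(\<Sum>r<b. stable_weight s [b] (rot r f)) \<le> ennreal (exp (rate s * ((block_sum f 0 b)\<^sup>2 / real b)))"
    for f
  proof (cases "\<exists>r<b. tight_block (\<lambda>i. f ((i + r) mod b)) 0 b")
    case True
    then obtain r where r: "r < b" "tight_block (\<lambda>i. f ((i + r) mod b)) 0 b" by blast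
    have "stable_weight s [b] (rot r' f) = 0" if "r' < b" "r' \<noteq> r" for r'
    proof -
      have "\<not> tight_block (\<lambda>i. f ((i + r') mod b)) 0 b"
        using tight_rotation_unique[of r r' b f] tight_rotation_unique[of r' r b f] r that
        by (metis linorder_neqE_nat)
      then show ?thesis unfolding rot_eq by (simp add: stable_weight_def)
    qed
    then have "(\<Sum>r<b. stable_weight s [b] (rot r f)) = (\<Sum>r\<in>{r}. stable_weight s [b] (rot r f))"
      using r(1) by (intro sum.mono_neutral_right) auto
    also have "\<dots> \<le> ennreal (exp (rate s * ((block_sum f 0 b)\<^sup>2 / real b)))"
      using block_sum_rotate[OF r(1), of f] unfolding rot_eq by (simp add: stable_weight_def)
    finally show ?thesis .
  next
    case False
    then show ?thesis
      unfolding rot_eq by (simp add: stable_weight_def)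
  qed
  have "of_nat b * (\<integral>\<^sup>+f. stable_weight s [b] f \<partial>gauss_pow b)
      = (\<Sum>r<b. \<integral>\<^sup>+f. stable_weight s [b] (rot r f) \<partial>gauss_pow b)"
    using inv by simp
  also have "\<dots> = (\<integral>\<^sup>+f. (\<Sum>r<b. stable_weight s [b] (rot r f)) \<partial>gauss_pow b)"
    using meas by (intro nn_integral_sum[symmetric]) auto
  also have "\<dots> \<le> (\<integral>\<^sup>+f. ennreal (exp (rate s * ((block_sum f 0 b)\<^sup>2 / real b))) \<partial>gauss_pow b)"
    by (intro nn_integral_mono le)
  also have "\<dots> = ennreal s"
    by (rule nn_integral_exp_rate_block_sum[OF assms])
  finally show ?thesis .
qed

subsection \<open>Insertion of a block\<close>

definition insert_block :: "nat \<Rightarrow> nat \<Rightarrow> (nat \<Rightarrow> real) \<Rightarrow> (nat \<Rightarrow> real) \<Rightarrow> nat \<Rightarrow> real" where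
  "insert_block p b g h i = (if i < p then g i else if i < p + b then h (i - p) else g (i - b))"

text \<open>The index map in the first product enumerates the positions outside the inserted block.
  The identity is used for the measures of boxes.\<close>

lemma prod_insert_block:
  fixes \<alpha> :: "nat \<Rightarrow> 'a::comm_monoid_mult"
  assumes "p \<le> n"
  shows "(\<Prod>i<n. \<alpha> (if i < p then i else i + b)) * (\<Prod>i<b. \<alpha> (p + i)) = (\<Prod>i<n + b. \<alpha> i)"
proof -
  define \<phi> where "\<phi> i = (if i < p then i else i + b)" for i
  have "inj_on \<phi> {..<n}" by (auto simp: \<phi>_def inj_on_def split: if_splits)
  then have "(\<Prod>i<n. \<alpha> (\<phi> i)) = prod \<alpha> (\<phi> ` {..<n})"
    by (simp add: prod.reindex)
  moreover have "(\<Prod>i<b. \<alpha> (p + i)) = prod \<alpha> ((+) p ` {..<b})"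
    by (simp add: prod.reindex)
  moreover have "prod \<alpha> (\<phi> ` {..<n}) * prod \<alpha> ((+) p ` {..<b}) = prod \<alpha> (\<phi> ` {..<n} \<union> (+) p ` {..<b})"
    by (intro prod.union_disjoint[symmetric]) (auto simp: \<phi>_def split: if_splits)
  moreover have "\<phi> ` {..<n} \<union> (+) p ` {..<b} = {..<n + b}"
  proof (intro equalityI subsetI)
    fix i assume i: "i \<in> {..<n + b}"
    consider "i < p" | "p \<le> i" "i < p + b" | "p + b \<le> i" by linarith
    then show "i \<in> \<phi> ` {..<n} \<union> (+) p ` {..<b}"
    proof cases
      case 1
      then have "i = \<phi> i" "i < n" using assms by (auto simp: \<phi>_def)
      then show ?thesis by blast
    next
      case 2
      then have "i = p + (i - p)" "i - p < b" by auto
      then show ?thesis by blast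
    next
      case 3
      then have "i = \<phi> (i - b)" "i - b < n" using i by (auto simp: \<phi>_def)
      then show ?thesis by blast
    qed
  qed (use assms in \<open>auto simp: \<phi>_def split: if_splits\<close>)
  ultimately show ?thesis by (simp add: \<phi>_def)
qed

lemma measurable_insert_block:
  assumes "p \<le> n"
  shows "(\<lambda>(g, h). restrict (insert_block p b g h) {..<n + b})
    \<in> measurable (gauss_pow n \<Otimes>\<^sub>M gauss_pow b) (gauss_pow (n + b))"
proof -
  have "(\<lambda>z. insert_block p b (fst z) (snd z) i) \<in> measurable (gauss_pow n \<Otimes>\<^sub>M gauss_pow b) gauss"
    if "i < n + b" for i
  proof -
    have meas_fst: "(\<lambda>z. fst z j) \<in> measurable (gauss_pow n \<Otimes>\<^sub>M gauss_pow b) gauss" if "j < n" for j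
      using that by (intro measurable_compose[OF measurable_fst measurable_component_singleton]) auto
    have meas_snd: "(\<lambda>z. snd z j) \<in> measurable (gauss_pow n \<Otimes>\<^sub>M gauss_pow b) gauss" if "j < b" for j
      using that by (intro measurable_compose[OF measurable_snd measurable_component_singleton]) auto
    consider "i < p" | "p \<le> i" "i < p + b" | "p + b \<le> i" by linarith
    then show ?thesis
    proof cases
      case 1
      then show ?thesis using meas_fst[of i] assms by (simp add: insert_block_def)
    next
      case 2
      then show ?thesis using meas_snd[of "i - p"] by (simp add: insert_block_def)
    next
      case 3
      then show ?thesis using meas_fst[of "i - b"] that by (simp add: insert_block_def)
    qed
  qed
  then show ?thesis
    unfolding case_prod_beta' by (intro measurable_restrict) auto
qed

text \<open>Insertion only relabels independent coordinates of equal law. It suffices to test boxes,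
  and the preimage of a box is the product of the boxes over the kept and over the inserted
  positions.\<close>

lemma distr_insert_block:
  assumes "p \<le> n"
  shows "distr (gauss_pow n \<Otimes>\<^sub>M gauss_pow b) (gauss_pow (n + b))
    (\<lambda>(g, h). restrict (insert_block p b g h) {..<n + b}) = gauss_pow (n + b)" (is "distr ?P ?Q ?f = _")
proof -
  interpret G: prob_space gauss by (rule prob_space_gauss)
  interpret product_sigma_finite "\<lambda>_::nat. gauss"
    by (simp add: product_sigma_finite_def G.sigma_finite_measure_axioms)
  interpret Gb: prob_space "gauss_pow b" by (rule prob_space_gauss_pow)
  show ?thesis
  proof (rule PiM_eqI)
    fix A :: "nat \<Rightarrow> real set" assume A: "\<And>i. i \<in> {..<n + b} \<Longrightarrow> A i \<in> sets gauss"
    define B where "B i = A (if i < p then i else i + b)" for i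
    define C where "C i = A (p + i)" for i
    have BC: "B i \<in> sets gauss" if "i < n" for i
      using A that unfolding B_def by auto
    have CC: "C i \<in> sets gauss" if "i < b" for i
      using A that assms unfolding C_def by auto
    have eq: "?f -` Pi\<^sub>E {..<n + b} A \<inter> space ?P = Pi\<^sub>E {..<n} B \<times> Pi\<^sub>E {..<b} C"
    proof (intro equalityI subsetI)
      fix z assume z: "z \<in> ?f -` Pi\<^sub>E {..<n + b} A \<inter> space ?P"
      obtain g h where gh: "z = (g, h)" by (cases z)
      have ext: "g \<in> extensional {..<n}" "h \<in> extensional {..<b}"
        using z by (auto simp: gh space_pair_measure space_PiM PiE_def)
      have in_A: "insert_block p b g h i \<in> A i" if "i < n + b" for i
        using z that by (auto simp: gh PiE_iff)
      have "g i \<in> B i" if "i < n" for i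
        using in_A[of i] in_A[of "i + b"] that by (auto simp: B_def insert_block_def)
      moreover have "h i \<in> C i" if "i < b" for i
        using in_A[of "p + i"] that assms by (auto simp: C_def insert_block_def)
      ultimately show "z \<in> Pi\<^sub>E {..<n} B \<times> Pi\<^sub>E {..<b} C"
        using ext by (auto simp: gh PiE_iff)
    next
      fix z assume z: "z \<in> Pi\<^sub>E {..<n} B \<times> Pi\<^sub>E {..<b} C"
      obtain g h where gh: "z = (g, h)" by (cases z)
      have g: "g i \<in> A (if i < p then i else i + b)" if "i < n" for i
        using z that by (auto simp: gh B_def PiE_iff)
      have h: "h i \<in> A (p + i)" if "i < b" for i
        using z that by (auto simp: gh C_def PiE_iff)
      have "insert_block p b g h i \<in> A i" if "i < n + b" for i
      proof -
        consider "i < p" | "p \<le> i" "i < p + b" | "p + b \<le> i" by linarith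
        then show ?thesis
        proof cases
          case 1
          then show ?thesis using g[of i] assms by (simp add: insert_block_def)
        next
          case 2
          then show ?thesis using h[of "i - p"] by (simp add: insert_block_def)
        next
          case 3
          then obtain j where j: "i = p + b + j" using le_Suc_ex by blast
          then show ?thesis using g[of "p + j"] that by (simp add: insert_block_def algebra_simps)
        qed
      qed
      then show "z \<in> ?f -` Pi\<^sub>E {..<n + b} A \<inter> space ?P"
        using z by (auto simp: gh space_pair_measure space_PiM PiE_iff)
    qed
    have "emeasure (distr ?P ?Q ?f) (Pi\<^sub>E {..<n + b} A) = emeasure ?P (Pi\<^sub>E {..<n} B \<times> Pi\<^sub>E {..<b} C)"
      using A measurable_insert_block[OF assms, of b]
      by (subst emeasure_distr) (auto simp: eq intro!: sets_PiM_I_finite)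
    also have "\<dots> = emeasure (gauss_pow n) (Pi\<^sub>E {..<n} B) * emeasure (gauss_pow b) (Pi\<^sub>E {..<b} C)"
      using BC CC by (intro Gb.emeasure_pair_measure_Times sets_PiM_I_finite) auto
    also have "\<dots> = (\<Prod>i<n. emeasure gauss (B i)) * (\<Prod>i<b. emeasure gauss (C i))"
      using BC CC by (subst (1 2) emeasure_PiM) auto
    also have "\<dots> = (\<Prod>i<n + b. emeasure gauss (A i))"
      unfolding B_def C_def by (rule prod_insert_block[OF assms])
    finally show "emeasure (distr ?P ?Q ?f) (Pi\<^sub>E {..<n + b} A) = (\<Prod>i<n + b. emeasure gauss (A i))" .
  qed simp_all
qed

text \<open>Every block of the longer sequence reads entries of only one of \<open>g\<close> and
  \<open>h\<close>, so tightness separates and the energies add up. The only interaction is that the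
  new mean has to fit between the means on its left and on its right.\<close>

lemma stable_weight_insert_block:
  fixes g h :: "nat \<Rightarrow> real" and b :: nat
  defines "m \<equiv> block_sum h 0 b / real b"
  shows "stable_weight s (c @ b # d)
      (restrict (insert_block (sum_list c) b g h) {..<sum_list c + sum_list d + b})
    = (if (\<forall>y\<in>set (block_means g 0 c). y \<le> m) \<and> (\<forall>y\<in>set (block_means g (sum_list c) d). m \<le> y)
       then stable_weight s (c @ d) g * stable_weight s [b] h else 0)"
proof -
  let ?p = "sum_list c"
  let ?f = "restrict (insert_block ?p b g h) {..<?p + sum_list d + b}"
  have 1: "block_means ?f 0 c = block_means g 0 c" "tight_blocks ?f 0 c = tight_blocks g 0 c"
      "energy ?f 0 c = energy g 0 c"
    by (rule blocks_cong; simp add: insert_block_def)+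
  have 2: "block_means ?f (?p + b) d = block_means g ?p d"
      "tight_blocks ?f (?p + b) d = tight_blocks g ?p d" "energy ?f (?p + b) d = energy g ?p d"
    by (rule blocks_cong; simp add: insert_block_def)+
  have 3: "block_sum ?f ?p b = block_sum h 0 b"
    by (rule block_sum_cong) (simp add: insert_block_def)
  have 4: "tight_block ?f ?p b = tight_block h 0 b"
    by (rule tight_block_cong) (simp add: insert_block_def)
  have sort: "sorted (block_means ?f 0 (c @ b # d)) \<longleftrightarrow> sorted (block_means g 0 (c @ d)) \<and>
     (\<forall>y\<in>set (block_means g 0 c). y \<le> m) \<and> (\<forall>y\<in>set (block_means g ?p d). m \<le> y)"
    unfolding block_means_append block_means.simps add_0_left 1 2 3 m_def[symmetric]
    by (auto simp: sorted_append intro: order_trans)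
  have tight: "tight_blocks ?f 0 (c @ b # d) \<longleftrightarrow> tight_blocks g 0 (c @ d) \<and> tight_block h 0 b"
    unfolding tight_blocks_append tight_blocks.simps add_0_left 1 2 3 4 by auto
  have energy: "energy ?f 0 (c @ b # d) = energy g 0 (c @ d) + energy h 0 [b]"
    unfolding energy_append energy.simps add_0_left 1 2 3 4 by simp
  show ?thesis
    unfolding stable_weight_def sort tight energy
    by (auto simp: distrib_left exp_add ennreal_mult)
qed

subsection \<open>Exponential moments\<close>

text \<open>The block sum has a density, so a tie with one of finitely many given means is a null
  event.\<close>

lemma AE_block_mean_notin:
  assumes "b > 0" "finite A"
  shows "AE h in gauss_pow b. block_sum h 0 b / real b \<notin> A"
proof -
  have "AE h in gauss_pow b. block_sum h 0 b \<noteq> a * real b" for a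
  proof -
    interpret prob_space "gauss_pow b" by (rule prob_space_gauss_pow)
    show ?thesis
      using AE_lborel_singleton[of "a * real b"]
      by (subst distributed_AE2[OF distributed_block_sum[OF assms(1)], where P = "\<lambda>x. x \<noteq> a * real b"]) auto
  qed
  then have "AE h in gauss_pow b. \<forall>a\<in>A. block_sum h 0 b \<noteq> a * real b"
    using assms(2) by (intro AE_finite_allI) auto
  then show ?thesis
    using assms(1) by (auto simp: field_simps elim!: eventually_mono)
qed

text \<open>If two positions \<open>i < j\<close> were possible, the entry with index
  \<open>i\<close> would lie to the right of the first and to the left of the second, hence be equal
  to \<open>m\<close>.\<close>

lemma insertion_position_unique:
  fixes m :: "'a::linorder"
  assumes "m \<notin> set L" "\<forall>y\<in>set (take i L). y \<le> m" "\<forall>y\<in>set (drop i L). m \<le> y"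
    "\<forall>y\<in>set (take j L). y \<le> m" "\<forall>y\<in>set (drop j L). m \<le> y" "i \<le> length L" "j \<le> length L"
  shows "i = (j :: nat)"
proof -
  have False if "i < j" "j \<le> length L" "\<forall>y\<in>set (drop i L). m \<le> y" "\<forall>y\<in>set (take j L). y \<le> m" for i j
  proof -
    have "L ! i \<in> set (drop i L)" "L ! i \<in> set (take j L)" "L ! i \<in> set L"
      using that by (auto simp: in_set_conv_nth intro: exI[of _ 0] exI[of _ i])
    with that assms(1) show False by (metis order_antisym)
  qed
  with assms show ?thesis by (metis linorder_neqE_nat)
qed

lemma block_means_take_drop:
  "block_means g p (take j c) = take j (block_means g p c)"
  "block_means g (p + sum_list (take j c)) (drop j c) = drop j (block_means g p c)"
proof -
  have "block_means g p c
      = block_means g p (take j c) @ block_means g (p + sum_list (take j c)) (drop j c)"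
    using block_means_append[of g p "take j c" "drop j c"] by simp
  then show "block_means g p (take j c) = take j (block_means g p c)"
    "block_means g (p + sum_list (take j c)) (drop j c) = drop j (block_means g p c)"
    by (simp_all add: min_def)
qed

text \<open>For given \<open>g\<close> and \<open>h\<close> each summand is the same product of
  weights times the indicator that the mean of \<open>h\<close> fits into slot \<open>j\<close>, and
  almost surely at most one slot fits.\<close>

lemma sum_nn_integral_insertions_le:
  assumes c: "c \<in> compositions n" and "b > 0"
  shows "(\<Sum>j\<le>length c. \<integral>\<^sup>+f. stable_weight s (take j c @ b # drop j c) f \<partial>gauss_pow (n + b))
    \<le> (\<integral>\<^sup>+g. stable_weight s c g \<partial>gauss_pow n) * (\<integral>\<^sup>+h. stable_weight s [b] h \<partial>gauss_pow b)"
proof -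
  interpret Gb: prob_space "gauss_pow b" by (rule prob_space_gauss_pow)
  define T where "T j = (\<lambda>(g, h). restrict (insert_block (sum_list (take j c)) b g h) {..<n + b})" for j
  define F where "F j z = stable_weight s (take j c @ b # drop j c) (T j z)" for j z
  have n: "n = sum_list (take j c) + sum_list (drop j c)" for j
    using c by (metis (mono_tags, lifting) append_take_drop_id compositions_def mem_Collect_eq sum_list_append)
  have T: "T j \<in> measurable (gauss_pow n \<Otimes>\<^sub>M gauss_pow b) (gauss_pow (n + b))" for j
    unfolding T_def using n[of j] by (intro measurable_insert_block) auto
  have sw: "stable_weight s (take j c @ b # drop j c) \<in> borel_measurable (gauss_pow (n + b))" for j
    using n[of j] by (intro measurable_stable_weight) simp
  have F: "F j \<in> borel_measurable (gauss_pow n \<Otimes>\<^sub>M gauss_pow b)" for j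
    unfolding F_def using measurable_compose[OF T sw] by simp
  have F_int: "(\<integral>\<^sup>+f. stable_weight s (take j c @ b # drop j c) f \<partial>gauss_pow (n + b))
      = (\<integral>\<^sup>+z. F j z \<partial>(gauss_pow n \<Otimes>\<^sub>M gauss_pow b))" for j
  proof -
    have "distr (gauss_pow n \<Otimes>\<^sub>M gauss_pow b) (gauss_pow (n + b)) (T j) = gauss_pow (n + b)"
      unfolding T_def using n[of j] by (intro distr_insert_block) auto
    then show ?thesis
      using nn_integral_distr[OF T, of "stable_weight s (take j c @ b # drop j c)" j] sw[of j]
      by (simp add: F_def)
  qed
  have F_le: "(\<Sum>j\<le>length c. F j (g, h)) \<le> stable_weight s c g * stable_weight s [b] h"
    if m: "block_sum h 0 b / real b \<notin> set (block_means g 0 c)" for g h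
  proof -
    define m where "m = block_sum h 0 b / real b"
    define L where "L = block_means g 0 c"
    define J where "J = {j \<in> {..length c}. (\<forall>y\<in>set (take j L). y \<le> m) \<and> (\<forall>y\<in>set (drop j L). m \<le> y)}"
    have F_eq: "F j (g, h) = (if j \<in> J then stable_weight s c g * stable_weight s [b] h else 0)"
      if "j \<le> length c" for j
      using stable_weight_insert_block[of s "take j c" b "drop j c" g h] that
        block_means_take_drop[of g 0 j c]
      by (simp add: F_def T_def n[of j, symmetric] J_def L_def m_def)
    have "card J \<le> 1"
    proof -
      have "\<forall>i\<in>J. \<forall>j\<in>J. i = j"
        using insertion_position_unique[of m L] m unfolding J_def m_def L_def by simp
      then show ?thesis
        using card_le_Suc0_iff_eq[of J] by (simp add: J_def)
    qed
    have "(\<Sum>j\<le>length c. F j (g, h))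
        = (\<Sum>j\<le>length c. if j \<in> J then stable_weight s c g * stable_weight s [b] h else 0)"
      by (intro sum.cong) (simp_all add: F_eq)
    also have "\<dots> = of_nat (card J) * (stable_weight s c g * stable_weight s [b] h)"
      by (subst sum.inter_restrict[symmetric]) (auto simp: J_def Int_def intro!: arg_cong[where f = card])
    also have "\<dots> \<le> 1 * (stable_weight s c g * stable_weight s [b] h)"
      using \<open>card J \<le> 1\<close> by (intro mult_right_mono) (auto simp: le_Suc_eq)
    finally show ?thesis by simp
  qed
  have "(\<Sum>j\<le>length c. \<integral>\<^sup>+f. stable_weight s (take j c @ b # drop j c) f \<partial>gauss_pow (n + b))
      = (\<integral>\<^sup>+z. (\<Sum>j\<le>length c. F j z) \<partial>(gauss_pow n \<Otimes>\<^sub>M gauss_pow b))"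
    using F by (simp add: F_int nn_integral_sum)
  \<comment> \<open>The null set of ties depends on \<open>g\<close>, hence \<open>h\<close> is
    integrated first.\<close>
  also have "\<dots> = (\<integral>\<^sup>+g. \<integral>\<^sup>+h. (\<Sum>j\<le>length c. F j (g, h)) \<partial>gauss_pow b \<partial>gauss_pow n)"
    using F by (intro Gb.nn_integral_fst[symmetric] borel_measurable_sum) auto
  also have "\<dots> \<le> (\<integral>\<^sup>+g. \<integral>\<^sup>+h. stable_weight s c g * stable_weight s [b] h \<partial>gauss_pow b \<partial>gauss_pow n)"
  proof (rule nn_integral_mono, rule nn_integral_mono_AE)
    fix g
    show "AE h in gauss_pow b. (\<Sum>j\<le>length c. F j (g, h)) \<le> stable_weight s c g * stable_weight s [b] h"
      using AE_block_mean_notin[OF assms(2), of "set (block_means g 0 c)"] by (auto intro: F_le)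
  qed
  also have "\<dots> = (\<integral>\<^sup>+g. stable_weight s c g * (\<integral>\<^sup>+h. stable_weight s [b] h \<partial>gauss_pow b) \<partial>gauss_pow n)"
    by (intro nn_integral_cong nn_integral_cmult measurable_stable_weight) simp
  also have "\<dots> = (\<integral>\<^sup>+g. stable_weight s c g \<partial>gauss_pow n) * (\<integral>\<^sup>+h. stable_weight s [b] h \<partial>gauss_pow b)"
    using c by (intro nn_integral_multc measurable_stable_weight) (simp add: compositions_def)
  finally show ?thesis .
qed

text \<open>A composition with a marked block corresponds to the size of that block, the composition
  left after deleting it, and the gap where it stood. A composition has one gap more than it has
  blocks, which is why \<open>j\<close> runs up to and including \<open>length c\<close>.\<close>

lemma sum_compositions_mark:
  fixes F :: "nat list \<Rightarrow> nat \<Rightarrow> nat list \<Rightarrow> 'a::comm_monoid_add"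
  shows "(\<Sum>c\<in>compositions N. \<Sum>j<length c. F (take j c) (c ! j) (drop (Suc j) c))
    = (\<Sum>b\<in>{1..N}. \<Sum>c\<in>compositions (N - b). \<Sum>j\<le>length c. F (take j c) b (drop j c))"
proof -
  have sum_remove: "sum_list c = sum_list (take j c) + c ! j + sum_list (drop (Suc j) c)"
    if "j < length c" for c :: "nat list" and j
    by (subst id_take_nth_drop[OF that]) simp
  have sum_split: "sum_list c = sum_list (take j c) + sum_list (drop j c)" for c :: "nat list" and j
    by (metis append_take_drop_id sum_list_append)
  have set_split: "set c = set (take j c) \<union> set (drop j c)" for c :: "nat list" and j
    by (metis append_take_drop_id set_append)
  have "(\<Sum>c\<in>compositions N. \<Sum>j<length c. F (take j c) (c ! j) (drop (Suc j) c))
    = (\<Sum>(c, j)\<in>Sigma (compositions N) (\<lambda>c. {..<length c}). F (take j c) (c ! j) (drop (Suc j) c))"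
    by (rule sum.Sigma) (auto simp: finite_compositions)
  also have "\<dots> = (\<Sum>(b, c, j)\<in>Sigma {1..N} (\<lambda>b. Sigma (compositions (N - b)) (\<lambda>c. {..length c})).
      F (take j c) b (drop j c))"
  proof (rule sum.reindex_bij_witness[where
      i = "\<lambda>(b, c, j). (take j c @ b # drop j c, j)"
      and j = "\<lambda>(c, j). (c ! j, take j c @ drop (Suc j) c, j)"])
    fix z assume z: "z \<in> Sigma (compositions N) (\<lambda>c. {..<length c})"
    obtain c j where [simp]: "z = (c, j)" by (cases z)
    have j: "j < length c" "sum_list c = N" "0 \<notin> set c" using z by (auto simp: compositions_def)
    show "(case (case z of (c, j) \<Rightarrow> (c ! j, take j c @ drop (Suc j) c, j)) of
        (b, c, j) \<Rightarrow> (take j c @ b # drop j c, j)) = z"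
      using j by (simp add: min_def id_take_nth_drop[symmetric])
    have "c ! j \<in> set c" using j by simp
    with j have "c ! j \<noteq> 0" by metis
    with j sum_remove[OF j(1)] show "(case z of (c, j) \<Rightarrow> (c ! j, take j c @ drop (Suc j) c, j))
        \<in> Sigma {1..N} (\<lambda>b. Sigma (compositions (N - b)) (\<lambda>c. {..length c}))"
      by (auto simp: compositions_def dest: in_set_takeD in_set_dropD)
    show "(case (case z of (c, j) \<Rightarrow> (c ! j, take j c @ drop (Suc j) c, j)) of
        (b, c, j) \<Rightarrow> F (take j c) b (drop j c))
      = (case z of (c, j) \<Rightarrow> F (take j c) (c ! j) (drop (Suc j) c))"
      using j by (simp add: min_def)
  next
    fix z assume z: "z \<in> Sigma {1..N} (\<lambda>b. Sigma (compositions (N - b)) (\<lambda>c. {..length c}))"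
    obtain b c j where [simp]: "z = (b, c, j)" by (cases z)
    have j: "j \<le> length c" "sum_list c = N - b" "0 \<notin> set c" "1 \<le> b" "b \<le> N"
      using z by (auto simp: compositions_def)
    show "(case (case z of (b, c, j) \<Rightarrow> (take j c @ b # drop j c, j)) of
        (c, j) \<Rightarrow> (c ! j, take j c @ drop (Suc j) c, j)) = z"
      using j by (simp add: min_def nth_append)
    show "(case z of (b, c, j) \<Rightarrow> (take j c @ b # drop j c, j))
        \<in> Sigma (compositions N) (\<lambda>c. {..<length c})"
      using j sum_split[of c j] set_split[of c j] by (auto simp: compositions_def)
  qed
  also have "\<dots> = (\<Sum>b\<in>{1..N}. \<Sum>(c, j)\<in>Sigma (compositions (N - b)) (\<lambda>c. {..length c}).
      F (take j c) b (drop j c))"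
    by (rule sum.Sigma[symmetric]) (auto simp: finite_compositions)
  also have "\<dots> = (\<Sum>b\<in>{1..N}. \<Sum>c\<in>compositions (N - b). \<Sum>j\<le>length c. F (take j c) b (drop j c))"
    by (intro sum.cong refl sum.Sigma[symmetric]) (auto simp: finite_compositions)
  finally show ?thesis .
qed

definition stable_total :: "real \<Rightarrow> nat \<Rightarrow> (nat \<Rightarrow> real) \<Rightarrow> ennreal" where
  "stable_total s n f = (\<Sum>c\<in>compositions n. stable_weight s c f)"

lemma measurable_stable_total: "stable_total s n \<in> borel_measurable (gauss_pow n)"
  unfolding stable_total_def[abs_def]
  by (intro borel_measurable_sum measurable_stable_weight) (simp add: compositions_def)

lemma nn_integral_stable_total:
  "(\<integral>\<^sup>+f. stable_total s n f \<partial>gauss_pow n) = (\<Sum>c\<in>compositions n. \<integral>\<^sup>+f. stable_weight s c f \<partial>gauss_pow n)"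
  unfolding stable_total_def
  by (intro nn_integral_sum measurable_stable_weight) (simp add: compositions_def)

text \<open>Marking one block of a composition of \<open>N\<close>, weighted by its size \<open>b\<close>, and deleting it.\<close>

lemma nn_integral_stable_total_rec:
  assumes "s > 0"
  shows "of_nat N * (\<integral>\<^sup>+f. stable_total s N f \<partial>gauss_pow N)
    \<le> ennreal s * (\<Sum>b\<in>{1..N}. \<integral>\<^sup>+f. stable_total s (N - b) f \<partial>gauss_pow (N - b))"
proof -
  let ?I = "\<lambda>c. \<integral>\<^sup>+f. stable_weight s c f \<partial>gauss_pow N"
  have "of_nat N * (\<integral>\<^sup>+f. stable_total s N f \<partial>gauss_pow N) = (\<Sum>c\<in>compositions N. of_nat N * ?I c)"
    by (simp add: nn_integral_stable_total sum_distrib_left)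
  also have "\<dots> = (\<Sum>c\<in>compositions N. \<Sum>j<length c.
      of_nat (c ! j) * ?I (take j c @ c ! j # drop (Suc j) c))"
  proof (intro sum.cong refl)
    fix c assume "c \<in> compositions N"
    then have "N = (\<Sum>j<length c. c ! j)"
      by (simp add: compositions_def sum_list_sum_nth atLeast0LessThan)
    then have "of_nat N * ?I c = (\<Sum>j<length c. of_nat (c ! j) * ?I c)"
      by (simp add: sum_distrib_right)
    also have "\<dots> = (\<Sum>j<length c. of_nat (c ! j) * ?I (take j c @ c ! j # drop (Suc j) c))"
      by (intro sum.cong refl) (simp add: id_take_nth_drop[symmetric])
    finally show "of_nat N * ?I c = \<dots>" .
  qed
  also have "\<dots> = (\<Sum>b\<in>{1..N}. \<Sum>c\<in>compositions (N - b). \<Sum>j\<le>length c.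
      of_nat b * ?I (take j c @ b # drop j c))"
    by (rule sum_compositions_mark[where F = "\<lambda>x b y. of_nat b * ?I (x @ b # y)"])
  also have "\<dots> \<le> (\<Sum>b\<in>{1..N}. ennreal s * (\<integral>\<^sup>+f. stable_total s (N - b) f \<partial>gauss_pow (N - b)))"
  proof (intro sum_mono)
    fix b assume b: "b \<in> {1..N}"
    let ?W = "\<integral>\<^sup>+h. stable_weight s [b] h \<partial>gauss_pow b"
    have "(\<Sum>c\<in>compositions (N - b). \<Sum>j\<le>length c. of_nat b * ?I (take j c @ b # drop j c))
        = of_nat b * (\<Sum>c\<in>compositions (N - b). \<Sum>j\<le>length c. ?I (take j c @ b # drop j c))"
      by (simp add: sum_distrib_left)
    also have "\<dots> \<le> of_nat b * (\<Sum>c\<in>compositions (N - b).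
        (\<integral>\<^sup>+g. stable_weight s c g \<partial>gauss_pow (N - b)) * ?W)"
      using sum_nn_integral_insertions_le[of _ "N - b" b s] b
      by (intro mult_left_mono sum_mono) auto
    also have "\<dots> = (of_nat b * ?W) * (\<integral>\<^sup>+f. stable_total s (N - b) f \<partial>gauss_pow (N - b))"
      by (simp add: nn_integral_stable_total sum_distrib_left mult_ac)
    \<comment> \<open>The marking weight \<open>b\<close> makes up for the probability
      \<open>1 / b\<close> that a block of length \<open>b\<close> is tight.\<close>
    also have "\<dots> \<le> ennreal s * (\<integral>\<^sup>+f. stable_total s (N - b) f \<partial>gauss_pow (N - b))"
      using nn_integral_stable_weight_single[of b s] b assms by (intro mult_right_mono) auto
    finally show "(\<Sum>c\<in>compositions (N - b). \<Sum>j\<le>length c. of_nat b * ?I (take j c @ b # drop j c))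
      \<le> ennreal s * (\<integral>\<^sup>+f. stable_total s (N - b) f \<partial>gauss_pow (N - b))" .
  qed
  finally show ?thesis by (simp add: sum_distrib_left)
qed

text \<open>The product solves the recursion with equality. It is the rising factorial of
  \<open>s\<close> divided by \<open>n!\<close>, that is, the generating function of the number of
  cycles of a uniform random permutation.\<close>

lemma nn_integral_stable_total_le:
  assumes "s \<ge> 1"
  shows "(\<integral>\<^sup>+f. stable_total s n f \<partial>gauss_pow n) \<le> ennreal (\<Prod>i=1..n. 1 + (s - 1) / real i)"
proof (induction n rule: less_induct)
  case (less n)
  define a where "a m = (\<Prod>i=1..m. 1 + (s - 1) / real i)" for m
  have a_nonneg: "0 \<le> a m" for m
    unfolding a_def using assms by (intro prod_nonneg) auto
  have a_rec: "s * (\<Sum>m<k. a m) = real k * a k" for k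
  proof (induction k)
    case (Suc k)
    have "real (Suc k) * a (Suc k) = (real k + s) * a k"
      by (simp add: a_def field_simps)
    with Suc show ?case by (simp add: algebra_simps)
  qed simp
  show ?case
  proof (cases "n = 0")
    \<comment> \<open>The only composition of 0 is the empty one, of energy 0 and weight 1.\<close>
    case True
    interpret prob_space "gauss_pow 0" by (rule prob_space_gauss_pow)
    show ?thesis
      using True emeasure_space_1 by (simp add: stable_total_def[abs_def] stable_weight_def)
  next
    case False
    have "of_nat n * (\<integral>\<^sup>+f. stable_total s n f \<partial>gauss_pow n)
        \<le> ennreal s * (\<Sum>b\<in>{1..n}. \<integral>\<^sup>+f. stable_total s (n - b) f \<partial>gauss_pow (n - b))"
      using assms by (intro nn_integral_stable_total_rec) simp
    also have "\<dots> \<le> ennreal s * (\<Sum>b\<in>{1..n}. ennreal (a (n - b)))"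
      using less.IH False by (intro mult_left_mono sum_mono) (auto simp: a_def)
    also have "(\<Sum>b\<in>{1..n}. ennreal (a (n - b))) = ennreal (\<Sum>m<n. a m)"
    proof -
      have "(\<Sum>b\<in>{1..n}. ennreal (a (n - b))) = (\<Sum>m<n. ennreal (a m))"
        by (rule sum.reindex_bij_witness[of _ "\<lambda>m. n - m" "\<lambda>b. n - b"]) auto
      then show ?thesis by (simp add: a_nonneg sum_ennreal)
    qed
    also have "ennreal s * ennreal (\<Sum>m<n. a m) = of_nat n * ennreal (a n)"
      using a_rec[of n] assms a_nonneg
      by (simp add: sum_nonneg ennreal_of_nat_eq_real_of_nat flip: ennreal_mult)
    finally have "of_nat n * (\<integral>\<^sup>+f. stable_total s n f \<partial>gauss_pow n) \<le> of_nat n * ennreal (a n)" .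
    then show ?thesis
      using False unfolding a_def by (subst (asm) ennreal_mult_le_mult_iff) auto
  qed
qed

lemma prod_le_exp_ln:
  assumes "s \<ge> 1" "n \<ge> 1"
  shows "(\<Prod>i=1..n. 1 + (s - 1) / real i) \<le> exp ((s - 1) * (1 + ln (real n)))"
proof -
  have harm: "(\<Sum>i=1..k. 1 / real i) \<le> 1 + ln (real k)" if "k \<ge> 1" for k
    using that
  proof (induction k rule: dec_induct)
    case (step k)
    have "ln (real k / real (Suc k)) \<le> real k / real (Suc k) - 1"
      using step by (intro ln_le_minus_one) simp
    then have "1 / real (Suc k) \<le> ln (real (Suc k)) - ln (real k)"
      using step by (simp add: ln_div field_simps)
    with step show ?case by simp
  qed simp
  have "(\<Prod>i=1..n. 1 + (s - 1) / real i) \<le> (\<Prod>i=1..n. exp ((s - 1) / real i))"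
    using assms by (intro prod_mono) (auto simp: add_nonneg_nonneg)
  also have "\<dots> = exp ((s - 1) * (\<Sum>i=1..n. 1 / real i))"
    by (simp add: exp_sum sum_distrib_left)
  also have "\<dots> \<le> exp ((s - 1) * (1 + ln (real n)))"
    using assms harm by (simp add: mult_left_mono)
  finally show ?thesis .
qed

subsection \<open>Deviation bounds\<close>

text \<open>The optimal \<open>s\<close> is the cube root of the squared ratio \<open>((sqrt \<delta> + sqrt (2 t)) / sqrt \<delta>)\<^sup>2\<close>; the
  claim then reduces to \<open>(w - 1)\<^sup>2 * (2 * w + 1) \<ge> 0\<close> for \<open>w = sqrt s\<close>.\<close>

lemma ex_Chernoff_parameter:
  assumes "\<delta> > 0" "t > 0"
  shows "\<exists>s>1. \<delta> * (s - 1) - rate s * (sqrt \<delta> + sqrt (2 * t))\<^sup>2 \<le> - t"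
proof -
  define r where "r = 1 + sqrt (2 * t) / sqrt \<delta>"
  define w where "w = root 3 r"
  have "r > 1" using assms by (simp add: r_def)
  then have w: "w > 1" and w3: "w ^ 3 = r" by (auto simp: w_def)
  have \<tau>: "sqrt \<delta> + sqrt (2 * t) = sqrt \<delta> * w ^ 3"
    using assms by (simp add: w3 r_def field_simps)
  have "sqrt (2 * t) = sqrt \<delta> * (w ^ 3 - 1)"
    using \<tau> by (simp add: algebra_simps)
  then have "(sqrt (2 * t))\<^sup>2 = (sqrt \<delta> * (w ^ 3 - 1))\<^sup>2" by simp
  then have t: "t = \<delta> * (w ^ 3 - 1)\<^sup>2 / 2"
    using assms by (simp add: power_mult_distrib)
  have rate: "rate (w\<^sup>2) * (sqrt \<delta> * w ^ 3)\<^sup>2 = \<delta> * (w ^ 6 - w\<^sup>2) / 2"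
    using assms w by (simp add: rate_def power_mult_distrib field_simps flip: power_mult power_add)
  have "\<delta> * (w\<^sup>2 - 1) - \<delta> * (w ^ 6 - w\<^sup>2) / 2 + \<delta> * (w ^ 3 - 1)\<^sup>2 / 2
      = - (\<delta> * ((w - 1)\<^sup>2 * (2 * w + 1)) / 2)"
    by (simp add: field_simps power2_eq_square eval_nat_numeral)
  also have "\<dots> \<le> 0"
    using assms w by simp
  finally have "\<delta> * (w\<^sup>2 - 1) - rate (w\<^sup>2) * (sqrt \<delta> + sqrt (2 * t))\<^sup>2 \<le> - t"
    unfolding \<tau> rate using t by linarith
  moreover have "w\<^sup>2 > 1" using w by (simp add: one_less_power)
  ultimately show ?thesis by blast
qed

text \<open>\<open>Q\<close> is the energy of a sorted tight composition of \<open>f\<close>, whose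
  weight is one of the summands of the total. The total is a measurable majorant, so no measurable
  choice of the composition has to be made.\<close>

lemma stable_total_energy:
  "\<exists>Q. 0 \<le> Q \<and> ennreal (exp (rate s * Q)) \<le> stable_total s n f \<and>
    (\<forall>v. mono_on {..<n} v \<longrightarrow> (\<Sum>i<n. f i * v i) \<le> sqrt Q * sqrt (\<Sum>i<n. (v i)\<^sup>2))"
proof -
  obtain c where c: "c \<in> compositions n" "sorted (block_means f 0 c)" "tight_blocks f 0 c"
    using ex_sorted_tight_composition[of n f 0] by blast
  have "ennreal (exp (rate s * energy f 0 c)) = stable_weight s c f"
    using c by (simp add: stable_weight_def)
  also have "\<dots> \<le> stable_total s n f"
    unfolding stable_total_def using c finite_compositions by (intro member_le_sum) auto
  finally show ?thesis
    using energy_nonneg[of f 0 c] sum_mult_le_sqrt_energy[of f 0 c] c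
    by (intro exI[of _ "energy f 0 c"]) (auto simp: compositions_def lessThan_atLeast0)
qed

lemma stable_total_cong:
  "(\<And>i. i < n \<Longrightarrow> f i = g i) \<Longrightarrow> stable_total s n f = stable_total s n g"
  unfolding stable_total_def
  by (intro sum.cong refl stable_weight_cong) (simp add: compositions_def)

section \<open>Gaussian noise on the pieces of an interval partition\<close>

context prob_space
begin

lemma distr_std_normal_vars:
  assumes "indep_vars (\<lambda>_. borel) X I" "I \<noteq> {}"
    and "\<And>i. i \<in> I \<Longrightarrow> distributed M lborel (X i) std_normal_density"
  shows "distr M (PiM I (\<lambda>_. gauss)) (\<lambda>\<omega>. \<lambda>i\<in>I. X i \<omega>) = PiM I (\<lambda>_. gauss)"
proof -
  have rv: "random_variable borel (X i)" if "i \<in> I" for i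
    using assms(1) that by (auto simp: indep_vars_def)
  have "distr M (PiM I (\<lambda>_. gauss)) (\<lambda>\<omega>. \<lambda>i\<in>I. X i \<omega>)
      = distr M (PiM I (\<lambda>_. borel)) (\<lambda>\<omega>. \<lambda>i\<in>I. X i \<omega>)"
    by (intro distr_cong sets_PiM_cong) auto
  also have "\<dots> = PiM I (\<lambda>i. distr M borel (X i))"
    using indep_vars_iff_distr_eq_PiM'[where I = I and M' = "\<lambda>_. borel" and X = X] assms rv by simp
  also have "\<dots> = PiM I (\<lambda>_. gauss)"
  proof (intro PiM_cong refl)
    fix i assume "i \<in> I"
    have "distr M borel (X i) = distr M lborel (X i)"
      by (intro distr_cong) auto
    then show "distr M borel (X i) = gauss"
      using distributed_distr_eq_density[OF assms(3)[OF \<open>i \<in> I\<close>]] by (simp add: gauss_def)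
  qed
  finally show ?thesis .
qed

text \<open>After scaling by \<open>\<epsilon> / \<sigma>\<close> and shifting the interval to start
  at 0, the noise is standard Gaussian. The sign serves the pieces on which vectors decrease; the
  normal law is symmetric.\<close>

lemma nn_integral_stable_total_interval:
  assumes ind: "indep_vars (\<lambda>_. borel) \<xi> I" and I: "I = {a..<a + l}" "l > 0"
    and normal: "\<And>i. i \<in> I \<Longrightarrow> distributed M lborel (\<xi> i) (normal_density 0 \<sigma>)"
    and "\<sigma> > 0" "\<epsilon> \<in> {1, - 1}" "s \<ge> 1"
  shows "(\<integral>\<^sup>+\<omega>. stable_total s l (\<lambda>i. \<epsilon> * \<xi> (a + i) \<omega> / \<sigma>) \<partial>M)
    \<le> ennreal (\<Prod>i=1..l. 1 + (s - 1) / real i)"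
proof -
  define X where "X i \<omega> = \<epsilon> * \<xi> i \<omega> / \<sigma>" for i \<omega>
  have X_ind: "indep_vars (\<lambda>_. borel) X I"
    unfolding X_def[abs_def]
    by (rule indep_vars_compose2[OF ind, of "\<lambda>_ x. \<epsilon> * x / \<sigma>"]) measurable
  have X_rv: "random_variable gauss (X i)" if "i \<in> I" for i
    using X_ind that by (auto simp: indep_vars_def cong: measurable_cong_sets)
  have "distributed M lborel (X i) std_normal_density" if "i \<in> I" for i
    using normal_density_affine[OF normal[OF that], of "\<epsilon> / \<sigma>" 0] assms
    by (auto simp: X_def[abs_def] abs_mult)
  then have law: "distr M (PiM I (\<lambda>_. gauss)) (\<lambda>\<omega>. \<lambda>i\<in>I. X i \<omega>) = PiM I (\<lambda>_. gauss)"
    using X_ind I by (intro distr_std_normal_vars) auto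
  define \<phi> where "\<phi> g = (\<lambda>i\<in>{..<l}. g (a + i))" for g :: "nat \<Rightarrow> real"
  have \<phi>: "\<phi> \<in> measurable (PiM I (\<lambda>_. gauss)) (gauss_pow l)"
    unfolding \<phi>_def I by (intro measurable_restrict measurable_component_singleton) auto
  have \<phi>_law: "distr (PiM I (\<lambda>_. gauss)) (gauss_pow l) \<phi> = gauss_pow l"
    unfolding \<phi>_def I by (intro distr_PiM_reindex prob_space_gauss) auto
  have X_meas: "(\<lambda>\<omega>. \<lambda>i\<in>I. X i \<omega>) \<in> measurable M (PiM I (\<lambda>_. gauss))"
    by (intro measurable_restrict X_rv)
  have "(\<integral>\<^sup>+f. stable_total s l f \<partial>gauss_pow l) = (\<integral>\<^sup>+g. stable_total s l (\<phi> g) \<partial>PiM I (\<lambda>_. gauss))"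
    using nn_integral_distr[OF \<phi>, of "stable_total s l"] measurable_stable_total by (simp add: \<phi>_law)
  also have "\<dots> = (\<integral>\<^sup>+\<omega>. stable_total s l (\<phi> (\<lambda>i\<in>I. X i \<omega>)) \<partial>M)"
    using nn_integral_distr[OF X_meas, of "\<lambda>g. stable_total s l (\<phi> g)"]
      measurable_compose[OF \<phi> measurable_stable_total[of s l]] by (simp add: law)
  also have "\<dots> = (\<integral>\<^sup>+\<omega>. stable_total s l (\<lambda>i. \<epsilon> * \<xi> (a + i) \<omega> / \<sigma>) \<partial>M)"
    by (intro nn_integral_cong stable_total_cong) (auto simp: \<phi>_def X_def I)
  finally show ?thesis
    using nn_integral_stable_total_le[OF assms(7), of l] by simp
qed

text \<open>A Chernoff bound for the sum of the energies of the pieces: the noise on disjoint pieces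
  is independent, so the exponential moments multiply. The event does not depend on
  \<open>v\<close>, so \<open>v\<close> may be chosen after the noise, as the estimator is.\<close>

lemma piecewise_monotone_deviation:
  fixes \<xi> :: "nat \<Rightarrow> 'a \<Rightarrow> real" and \<epsilon> :: "nat set \<Rightarrow> real"
  assumes ind: "indep_vars (\<lambda>_. borel) \<xi> {1..n}"
    and normal: "\<And>i. i \<in> {1..n} \<Longrightarrow> distributed M lborel (\<xi> i) (normal_density 0 \<sigma>)"
    and P: "partition_on {1..n} P" "\<And>I. I \<in> P \<Longrightarrow> \<exists>a b. I = {a..b}"
    and \<epsilon>: "\<And>I. I \<in> P \<Longrightarrow> \<epsilon> I \<in> {1, - 1}"
    and "\<sigma> > 0" "s > 1" "\<tau> \<ge> 0"
  shows "\<exists>E\<in>events. prob E \<ge> 1 - (\<Prod>I\<in>P. \<Prod>i=1..card I. 1 + (s - 1) / real i) * exp (- rate s * \<tau>\<^sup>2) \<and>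
    (\<forall>\<omega>\<in>E. \<forall>v. (\<forall>I\<in>P. mono_on I (\<lambda>i. \<epsilon> I * v i)) \<longrightarrow>
      (\<Sum>i=1..n. \<xi> i \<omega> * v i) \<le> \<sigma> * \<tau> * sqrt (\<Sum>i=1..n. (v i)\<^sup>2))"
proof -
  have finP: "finite P" using P(1) finite_elements by blast
  have disj: "disjoint P" and UnP: "\<Union>P = {1..n}" using P(1) by (auto simp: partition_on_def)
  have I_eq: "I = {Min I..<Min I + card I}" and I_pos: "card I > 0" and I_sub: "I \<subseteq> {1..n}"
    if I: "I \<in> P" for I
  proof -
    obtain a b where ab: "I = {a..b}" using P(2)[OF I] by blast
    have "I \<noteq> {}" using P(1) I by (auto simp: partition_on_def)
    then have "a \<le> b" by (simp add: ab)
    then have "Min I = a" by (auto simp: ab intro!: Min_eqI)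
    then show "I = {Min I..<Min I + card I}" using \<open>a \<le> b\<close> by (auto simp: ab)
    show "card I > 0" using \<open>a \<le> b\<close> by (simp add: ab)
    show "I \<subseteq> {1..n}" using I UnP by auto
  qed
  define H where "H I g = stable_total s (card I) (\<lambda>i. \<epsilon> I * g (Min I + i) / \<sigma>)"
    for I and g :: "nat \<Rightarrow> real"
  \<comment> \<open>Written as a function of the noise restricted to \<open>I\<close>, so that
    independence passes from the disjoint index sets to the variables \<open>Y I\<close>.\<close>
  define Y where "Y I \<omega> = H I (\<lambda>i\<in>I. \<xi> i \<omega>)" for I \<omega>
  have mem: "Min I + i \<in> I" if "I \<in> P" "i < card I" for I i
  proof -
    have "Min I + i \<in> {Min I..<Min I + card I}" using that(2) by simp
    then show ?thesis using I_eq[OF that(1)] by blast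
  qed
  have Y_eq: "Y I \<omega> = stable_total s (card I) (\<lambda>i. \<epsilon> I * \<xi> (Min I + i) \<omega> / \<sigma>)" if "I \<in> P" for I \<omega>
    unfolding Y_def H_def using mem[OF that] by (intro stable_total_cong) simp
  have H_meas: "H I \<in> borel_measurable (PiM I (\<lambda>_. borel))" if I: "I \<in> P" for I
  proof -
    have "(\<lambda>g. \<lambda>i\<in>{..<card I}. \<epsilon> I * g (Min I + i) / \<sigma>) \<in> measurable (PiM I (\<lambda>_. borel)) (gauss_pow (card I))"
    proof (intro measurable_restrict)
      fix i assume "i \<in> {..<card I}"
      then have [measurable]: "(\<lambda>g. g (Min I + i)) \<in> borel_measurable (PiM I (\<lambda>_. borel))"
        using mem[OF I] by (intro measurable_component_singleton) auto
      have "(\<lambda>g. \<epsilon> I * g (Min I + i) / \<sigma>) \<in> borel_measurable (PiM I (\<lambda>_. borel))"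
        by measurable
      then show "(\<lambda>g. \<epsilon> I * g (Min I + i) / \<sigma>) \<in> measurable (PiM I (\<lambda>_. borel)) gauss"
        by (simp cong: measurable_cong_sets)
    qed
    from measurable_compose[OF this measurable_stable_total[of s "card I"]]
    have "(\<lambda>g. stable_total s (card I) (\<lambda>i\<in>{..<card I}. \<epsilon> I * g (Min I + i) / \<sigma>))
      \<in> borel_measurable (PiM I (\<lambda>_. borel))" .
    also have "(\<lambda>g. stable_total s (card I) (\<lambda>i\<in>{..<card I}. \<epsilon> I * g (Min I + i) / \<sigma>)) = H I"
      unfolding H_def by (intro ext stable_total_cong) simp
    finally show ?thesis .
  qed
  have "indep_vars (\<lambda>I. PiM I (\<lambda>_. borel)) (\<lambda>I \<omega>. restrict (\<lambda>i. \<xi> i \<omega>) I) P"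
    using I_sub disj by (intro indep_vars_restrict[OF ind]) (auto simp: disjoint_family_on_def disjoint_def)
  then have Y_ind: "indep_vars (\<lambda>_. borel) Y P"
    unfolding Y_def[abs_def] using H_meas by (rule indep_vars_compose2) auto
  then have Y_meas [measurable]: "Y I \<in> borel_measurable M" if "I \<in> P" for I
    using that by (auto simp: indep_vars_def)
  define Z where "Z \<omega> = (\<Prod>I\<in>P. Y I \<omega>)" for \<omega>
  have Z_meas [measurable]: "Z \<in> borel_measurable M"
    unfolding Z_def[abs_def] by (intro borel_measurable_prod_ennreal Y_meas)
  define B where "B = (\<Prod>I\<in>P. \<Prod>i=1..card I. 1 + (s - 1) / real i)"
  have fac_nonneg: "0 \<le> (\<Prod>i=1..k. 1 + (s - 1) / real i)" for k
    using assms by (intro prod_nonneg) auto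
  have Y_int: "(\<integral>\<^sup>+\<omega>. Y I \<omega> \<partial>M) \<le> ennreal (\<Prod>i=1..card I. 1 + (s - 1) / real i)" if I: "I \<in> P" for I
    unfolding Y_eq[OF I]
  proof (rule nn_integral_stable_total_interval[OF _ I_eq[OF I] I_pos[OF I] _ \<open>\<sigma> > 0\<close> \<epsilon>[OF I]])
    show "indep_vars (\<lambda>_. borel) \<xi> I"
      using ind I_sub[OF I] by (rule indep_vars_subset)
    show "distributed M lborel (\<xi> i) (normal_density 0 \<sigma>)" if "i \<in> I" for i
      using normal I_sub[OF I] that by blast
  qed (use \<open>s > 1\<close> in simp)
  have "(\<integral>\<^sup>+\<omega>. Z \<omega> \<partial>M) = (\<Prod>I\<in>P. \<integral>\<^sup>+\<omega>. Y I \<omega> \<partial>M)"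
    unfolding Z_def using finP Y_ind by (intro indep_vars_nn_integral) auto
  also have "\<dots> \<le> (\<Prod>I\<in>P. ennreal (\<Prod>i=1..card I. 1 + (s - 1) / real i))"
    using Y_int by (intro prod_mono_ennreal) auto
  also have "\<dots> = ennreal B"
    unfolding B_def using fac_nonneg by (intro prod_ennreal) auto
  finally have Z_int: "(\<integral>\<^sup>+\<omega>. Z \<omega> \<partial>M) \<le> ennreal B" .
  have B: "0 \<le> B" unfolding B_def by (intro prod_nonneg[of P] fac_nonneg)
  define T where "T = exp (rate s * \<tau>\<^sup>2)"
  define E where "E = {\<omega>\<in>space M. Z \<omega> < ennreal T}"
  have E: "E \<in> events" unfolding E_def by measurable
  have "emeasure M (space M - E) \<le> ennreal (B / T)"
  proof -
    have T: "T > 0" by (simp add: T_def)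
    \<comment> \<open>Brings the event into the form with threshold 1 in which Markov's inequality
      is applied.\<close>
    have T_le_iff: "ennreal T \<le> z \<longleftrightarrow> 1 \<le> ennreal (1 / T) * z" for z
    proof -
      have inv: "ennreal (1 / T) * ennreal T = 1"
        using T by (simp flip: ennreal_mult)
      show ?thesis
      proof
        assume "ennreal T \<le> z"
        then have "ennreal (1 / T) * ennreal T \<le> ennreal (1 / T) * z"
          by (rule mult_left_mono) simp
        then show "1 \<le> ennreal (1 / T) * z" by (simp only: inv)
      next
        assume "1 \<le> ennreal (1 / T) * z"
        then have "ennreal T * 1 \<le> ennreal T * (ennreal (1 / T) * z)"
          by (rule mult_left_mono) simp
        also have "\<dots> = (ennreal (1 / T) * ennreal T) * z"
          by (simp only: mult_ac)
        finally show "ennreal T \<le> z" by (simp only: inv mult_1_left mult_1_right)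
      qed
    qed
    have "space M - E = {\<omega>\<in>space M. ennreal T \<le> Z \<omega>}"
      by (auto simp: E_def not_less)
    also have "\<dots> = {\<omega>\<in>space M. 1 \<le> ennreal (1 / T) * Z \<omega>}"
      by (simp only: T_le_iff)
    also have "emeasure M \<dots> \<le> ennreal (1 / T) * (\<integral>\<^sup>+\<omega>. Z \<omega> * indicator (space M) \<omega> \<partial>M)"
      by (intro nn_integral_Markov_inequality) auto
    also have "(\<integral>\<^sup>+\<omega>. Z \<omega> * indicator (space M) \<omega> \<partial>M) = (\<integral>\<^sup>+\<omega>. Z \<omega> \<partial>M)"
      by (intro nn_integral_cong) simp
    also have "ennreal (1 / T) * (\<integral>\<^sup>+\<omega>. Z \<omega> \<partial>M) \<le> ennreal (1 / T) * ennreal B"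
      by (intro mult_left_mono Z_int) simp
    also have "\<dots> = ennreal (B / T)"
      using T B by (simp flip: ennreal_mult)
    finally show ?thesis .
  qed
  then have "prob (space M - E) \<le> B / T"
    using B by (simp add: emeasure_eq_measure T_def)
  then have "prob E \<ge> 1 - B * exp (- rate s * \<tau>\<^sup>2)"
    using prob_compl[OF E] by (simp add: T_def exp_minus field_simps)
  moreover have "(\<Sum>i=1..n. \<xi> i \<omega> * v i) \<le> \<sigma> * \<tau> * sqrt (\<Sum>i=1..n. (v i)\<^sup>2)"
    if \<omega>: "\<omega> \<in> E" and v: "\<forall>I\<in>P. mono_on I (\<lambda>i. \<epsilon> I * v i)" for \<omega> v
  proof -
    have "\<exists>Q. 0 \<le> Q \<and> ennreal (exp (rate s * Q)) \<le> Y I \<omega> \<and>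
        (\<Sum>i\<in>I. \<xi> i \<omega> * v i) \<le> \<sigma> * (sqrt Q * sqrt (\<Sum>i\<in>I. (v i)\<^sup>2))" if I: "I \<in> P" for I
    proof -
      define a where "a = Min I"
      define l where "l = card I"
      have I_al: "I = {a..<a + l}" unfolding a_def l_def by (rule I_eq[OF I])
      have sum_I: "sum f I = (\<Sum>i<l. f (a + i))" for f :: "nat \<Rightarrow> real"
        unfolding I_al using sum.shift_bounds_nat_ivl[of f 0 a l]
        by (simp add: add.commute lessThan_atLeast0)
      obtain Q where Q: "0 \<le> Q" "ennreal (exp (rate s * Q)) \<le> Y I \<omega>"
        and Q_dev: "\<forall>v. mono_on {..<l} v \<longrightarrow>
          (\<Sum>i<l. \<epsilon> I * \<xi> (a + i) \<omega> / \<sigma> * v i) \<le> sqrt Q * sqrt (\<Sum>i<l. (v i)\<^sup>2)"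
        using stable_total_energy[of s l "\<lambda>i. \<epsilon> I * \<xi> (a + i) \<omega> / \<sigma>"]
        unfolding Y_eq[OF I] a_def[symmetric] l_def[symmetric] by (elim exE conjE)
      have "mono_on {..<l} (\<lambda>i. \<epsilon> I * v (a + i))"
        using v I by (auto simp: mono_on_def I_al)
      \<comment> \<open>The bound is applied to \<open>\<epsilon> I * v\<close>; the sign meets its
        own square, which is 1, and drops out.\<close>
      from Q_dev[rule_format, OF this] have "(\<Sum>i<l. \<xi> (a + i) \<omega> * v (a + i) / \<sigma>) \<le> sqrt Q * sqrt (\<Sum>i<l. (v (a + i))\<^sup>2)"
        using \<epsilon>[OF I] by auto
      then have "(\<Sum>i\<in>I. \<xi> i \<omega> * v i) / \<sigma> \<le> sqrt Q * sqrt (\<Sum>i\<in>I. (v i)\<^sup>2)"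
        by (simp add: sum_I sum_divide_distrib)
      then show ?thesis
        using Q(1,2) \<open>\<sigma> > 0\<close> by (auto simp: field_simps)
    qed
    then have "\<forall>I\<in>P. \<exists>Q. 0 \<le> Q \<and> ennreal (exp (rate s * Q)) \<le> Y I \<omega> \<and>
        (\<Sum>i\<in>I. \<xi> i \<omega> * v i) \<le> \<sigma> * (sqrt Q * sqrt (\<Sum>i\<in>I. (v i)\<^sup>2))"
      by (rule ballI)
    \<comment> \<open>The choice is made for a fixed \<open>\<omega>\<close>, so no measurability of
      \<open>Q\<close> in \<open>\<omega>\<close> is involved.\<close>
    from bchoice[OF this] obtain Q where *: "\<forall>I\<in>P. 0 \<le> Q I \<and> ennreal (exp (rate s * Q I)) \<le> Y I \<omega> \<and>
        (\<Sum>i\<in>I. \<xi> i \<omega> * v i) \<le> \<sigma> * (sqrt (Q I) * sqrt (\<Sum>i\<in>I. (v i)\<^sup>2))"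
      by (elim exE)
    have Q: "0 \<le> Q I" "ennreal (exp (rate s * Q I)) \<le> Y I \<omega>"
      "(\<Sum>i\<in>I. \<xi> i \<omega> * v i) \<le> \<sigma> * (sqrt (Q I) * sqrt (\<Sum>i\<in>I. (v i)\<^sup>2))" if "I \<in> P" for I
      using bspec[OF * that] by simp_all
    have "ennreal (exp (rate s * (\<Sum>I\<in>P. Q I))) = (\<Prod>I\<in>P. ennreal (exp (rate s * Q I)))"
      using finP by (simp add: sum_distrib_left exp_sum prod_ennreal)
    also have "\<dots> \<le> Z \<omega>"
      unfolding Z_def using Q by (intro prod_mono_ennreal) auto
    also have "\<dots> < ennreal T"
      using \<omega> by (simp add: E_def)
    finally have "rate s * (\<Sum>I\<in>P. Q I) < rate s * \<tau>\<^sup>2"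
      by (simp add: T_def ennreal_less_iff)
    moreover have "rate s > 0"
      using \<open>s > 1\<close> by (simp add: rate_def one_less_power)
    ultimately have Q_le: "(\<Sum>I\<in>P. Q I) \<le> \<tau>\<^sup>2" by simp
    have "\<forall>I\<in>P. finite I"
      using I_sub finite_subset finite_atLeastAtMost by metis
    then have sum_P: "(\<Sum>i=1..n. f i) = (\<Sum>I\<in>P. \<Sum>i\<in>I. f i)" for f :: "nat \<Rightarrow> real"
      using sum.Union_disjoint_sets[of P f] disj UnP by (simp add: o_def)
    have "(\<Sum>i=1..n. \<xi> i \<omega> * v i) \<le> (\<Sum>I\<in>P. \<sigma> * (sqrt (Q I) * sqrt (\<Sum>i\<in>I. (v i)\<^sup>2)))"
      unfolding sum_P by (intro sum_mono Q)
    also have "\<dots> = \<sigma> * (\<Sum>I\<in>P. \<bar>sqrt (Q I)\<bar> * \<bar>sqrt (\<Sum>i\<in>I. (v i)\<^sup>2)\<bar>)"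
      using Q(1) by (simp add: sum_distrib_left sum_nonneg)
    also have "\<dots> \<le> \<sigma> * (L2_set (\<lambda>I. sqrt (Q I)) P * L2_set (\<lambda>I. sqrt (\<Sum>i\<in>I. (v i)\<^sup>2)) P)"
      using \<open>\<sigma> > 0\<close> by (intro mult_left_mono L2_set_mult_ineq) auto
    also have "L2_set (\<lambda>I. sqrt (\<Sum>i\<in>I. (v i)\<^sup>2)) P = sqrt (\<Sum>i=1..n. (v i)\<^sup>2)"
      unfolding sum_P by (simp add: L2_set_def sum_nonneg)
    also have "L2_set (\<lambda>I. sqrt (Q I)) P = sqrt (\<Sum>I\<in>P. Q I)"
      using Q(1) by (simp add: L2_set_def)
    also have "\<sigma> * (sqrt (\<Sum>I\<in>P. Q I) * sqrt (\<Sum>i=1..n. (v i)\<^sup>2))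
        \<le> \<sigma> * (\<tau> * sqrt (\<Sum>i=1..n. (v i)\<^sup>2))"
      using \<open>\<sigma> > 0\<close> \<open>\<tau> \<ge> 0\<close> Q_le
      by (intro mult_left_mono mult_right_mono real_le_lsqrt) (auto simp: sum_nonneg)
    finally show ?thesis by (simp add: mult.assoc)
  qed
  ultimately show ?thesis
    unfolding B_def by (intro bexI[OF _ E] conjI ballI allI impI)
qed

end

subsection \<open>Least squares and interval partitions\<close>

lemma scaled_norm_eq_L2_set: "scaled_norm n v = L2_set v {1..n} / sqrt (real n)"
  by (simp add: scaled_norm_def L2_set_def real_sqrt_divide)

text \<open>Comparing \<open>w\<close> with the single competitor \<open>u\<close> and expanding the
  squares bounds \<open>a\<^sup>2 - b\<^sup>2\<close> by twice the inner product of \<open>z\<close>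
  with \<open>w - u\<close>; this covers non-convex \<open>K\<close>. The norm of
  \<open>w - u\<close> is at most \<open>a + b\<close>, and dividing by \<open>a + b\<close> leaves
  \<open>a \<le> b + 2 * R\<close>.\<close>

lemma least_squares_deviation:
  assumes LS: "is_least_squares n K y w" and u: "u \<in> K" and "n \<ge> 1" "R \<ge> 0"
    and y: "\<And>i. i \<in> {1..n} \<Longrightarrow> y i = \<mu> i + z i"
    and dev: "(\<Sum>i=1..n. z i * (w i - u i)) \<le> R * sqrt (\<Sum>i=1..n. (w i - u i)\<^sup>2)"
  shows "scaled_norm n (\<lambda>i. w i - \<mu> i) \<le> scaled_norm n (\<lambda>i. u i - \<mu> i) + 2 * R / sqrt (real n)"
proof -
  define a where "a = L2_set (\<lambda>i. w i - \<mu> i) {1..n}"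
  define b where "b = L2_set (\<lambda>i. u i - \<mu> i) {1..n}"
  have a2: "a\<^sup>2 = (\<Sum>i=1..n. (w i - \<mu> i)\<^sup>2)" and b2: "b\<^sup>2 = (\<Sum>i=1..n. (u i - \<mu> i)\<^sup>2)"
    by (simp_all add: a_def b_def L2_set_def sum_nonneg)
  have ab: "a \<ge> 0" "b \<ge> 0" by (simp_all add: a_def b_def)
  have "(scaled_norm n (\<lambda>i. y i - w i))\<^sup>2 \<le> (scaled_norm n (\<lambda>i. y i - u i))\<^sup>2"
    using LS u unfolding is_least_squares_def is_arg_min_def by force
  then have "(\<Sum>i=1..n. (y i - w i)\<^sup>2) \<le> (\<Sum>i=1..n. (y i - u i)\<^sup>2)"
    using \<open>n \<ge> 1\<close> by (simp add: scaled_norm_def sum_nonneg divide_le_cancel)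
  moreover have "(\<Sum>i=1..n. (y i - u i)\<^sup>2) - (\<Sum>i=1..n. (y i - w i)\<^sup>2)
      = b\<^sup>2 - a\<^sup>2 + 2 * (\<Sum>i=1..n. z i * (w i - u i))"
    unfolding a2 b2 sum_distrib_left sum_subtractf[symmetric] sum.distrib[symmetric]
    by (intro sum.cong refl) (simp add: y power2_eq_square algebra_simps)
  ultimately have 1: "a\<^sup>2 \<le> b\<^sup>2 + 2 * (\<Sum>i=1..n. z i * (w i - u i))" by linarith
  have "sqrt (\<Sum>i=1..n. (w i - u i)\<^sup>2) = L2_set (\<lambda>i. (w i - \<mu> i) + - (u i - \<mu> i)) {1..n}"
    by (simp add: L2_set_def)
  also have "\<dots> \<le> a + L2_set (\<lambda>i. - (u i - \<mu> i)) {1..n}"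
    unfolding a_def by (rule L2_set_triangle_ineq)
  also have "L2_set (\<lambda>i. - (u i - \<mu> i)) {1..n} = b"
    unfolding b_def L2_set_def by (simp only: power2_minus)
  finally have "R * sqrt (\<Sum>i=1..n. (w i - u i)\<^sup>2) \<le> R * (a + b)"
    using \<open>R \<ge> 0\<close> by (rule mult_left_mono)
  with 1 dev have "a\<^sup>2 \<le> b\<^sup>2 + 2 * (R * (a + b))" by linarith
  then have "(a - b) * (a + b) \<le> (2 * R) * (a + b)"
    by (simp add: power2_eq_square algebra_simps)
  then have "a \<le> b + 2 * R"
    using ab \<open>R \<ge> 0\<close> by (cases "a + b = 0") (auto simp: mult_le_cancel_right)
  then show ?thesis
    unfolding scaled_norm_eq_L2_set a_def[symmetric] b_def[symmetric] add_divide_distrib[symmetric]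
    using \<open>n \<ge> 1\<close> by (intro divide_right_mono) auto
qed

text \<open>The piece containing \<open>m\<close> is cut right behind \<open>m\<close>; any other
  piece is an interval that misses \<open>m\<close> and so lies on one side of it. A sequence with
  mode \<open>m\<close> is then monotone on every piece.\<close>

lemma split_interval_partition:
  assumes P: "partition_on {1..n} P" "\<forall>I\<in>P. \<exists>a b. I = {a..b}" and m: "m \<in> {1..n::nat}"
  shows "\<exists>P'. partition_on {1..n} P' \<and> card P' \<le> card P + 1 \<and>
    (\<forall>I\<in>P'. (\<exists>a b. I = {a..b}) \<and> (\<exists>J\<in>P. I \<subseteq> J) \<and> (I \<subseteq> {1..m} \<or> I \<subseteq> {m..n}))"
proof -
  have finP: "finite P" using P(1) finite_elements by blast
  have UnP: "\<Union>P = {1..n}" and disj: "disjoint P" and ne: "{} \<notin> P"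
    using P(1) by (auto simp: partition_on_def)
  obtain I0 where I0: "I0 \<in> P" "m \<in> I0" using m UnP by blast
  obtain a0 b0 where ab0: "I0 = {a0..b0}" using P(2) I0(1) by blast
  define L where "L = I0 \<inter> {..m}"
  define R where "R = I0 \<inter> {m<..}"
  \<comment> \<open>\<open>R\<close> is empty if \<open>m\<close> is the right end of its piece, and
    a partition may not contain the empty set.\<close>
  define P' where "P' = (P - {I0}) \<union> ({L, R} - {{}})"
  have LR: "L = {a0..m}" "R = {Suc m..b0}"
    using I0(2) by (auto simp: L_def R_def ab0)
  have other: "I \<inter> I0 = {}" if "I \<in> P" "I \<noteq> I0" for I
    using disj that I0(1) by (auto simp: disjoint_def)
  show ?thesis
  proof (intro exI[of _ P'] conjI ballI)
    show "partition_on {1..n} P'"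
      unfolding partition_on_def
    proof (intro conjI)
      have "L \<union> R = I0" by (auto simp: L_def R_def)
      then have "\<Union>P' = \<Union>(P - {I0}) \<union> I0" by (auto simp: P'_def)
      also have "\<dots> = {1..n}" using UnP I0(1) by auto
      finally show "\<Union>P' = {1..n}" .
      have sub: "L \<subseteq> I0" "R \<subseteq> I0" "L \<inter> R = {}" by (auto simp: L_def R_def)
      show "disjoint P'"
        unfolding disjoint_def
      proof (intro ballI impI)
        fix A B assume AB: "A \<in> P'" "B \<in> P'" "A \<noteq> B"
        consider "A \<in> P - {I0}" "B \<in> P - {I0}" | "A \<in> P - {I0}" "B \<in> {L, R}"
          | "A \<in> {L, R}" "B \<in> P - {I0}" | "A \<in> {L, R}" "B \<in> {L, R}"
          using AB(1,2) unfolding P'_def by blast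
        then show "A \<inter> B = {}"
        proof cases
          case 1
          then show ?thesis using disj AB(3) by (auto simp: disjoint_def)
        next
          case 2
          then show ?thesis using other[of A] sub by blast
        next
          case 3
          then show ?thesis using other[of B] sub by blast
        next
          case 4
          then show ?thesis using sub AB(3) by blast
        qed
      qed
      show "{} \<notin> P'" using ne by (auto simp: P'_def)
    qed
    have "card P' \<le> card (P - {I0}) + card ({L, R} - {{}})"
      unfolding P'_def by (rule card_Un_le)
    also have "card ({L, R} - {{}}) \<le> card {L, R}" by (intro card_mono) auto
    also have "card {L, R} \<le> 2" by (simp add: card_insert_if)
    also have "card (P - {I0}) + 2 = card P + 1"
      using card_Suc_Diff1[OF finP I0(1)] by simp
    finally show "card P' \<le> card P + 1" by simp
    fix I assume I: "I \<in> P'"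
    show "\<exists>a b. I = {a..b}"
      using I P(2) LR unfolding P'_def by blast
    show "\<exists>J\<in>P. I \<subseteq> J"
      using I I0(1) by (auto simp: P'_def L_def R_def)
    show "I \<subseteq> {1..m} \<or> I \<subseteq> {m..n}"
    proof (cases "I \<in> P - {I0}")
      case True
      then obtain a b where ab: "I = {a..b}" using P(2) by blast
      have "m \<notin> I" using other[of I] True I0(2) by blast
      moreover have "I \<subseteq> {1..n}" using True UnP by blast
      ultimately show ?thesis unfolding ab by (auto simp: subset_iff)
    next
      case False
      then have "I = L \<or> I = R" using I unfolding P'_def by blast
      moreover have "I0 \<subseteq> {1..n}" using I0 UnP by blast
      ultimately show ?thesis unfolding L_def R_def by auto
    qed
  qed
qed

lemma singleton_partition:
  "partition_on {1..n::nat} ((\<lambda>i. {i}) ` {1..n})"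
  "I \<in> (\<lambda>i. {i}) ` {1..n} \<Longrightarrow> \<exists>a b. I = {a..b}"
proof -
  show "partition_on {1..n} ((\<lambda>i. {i}) ` {1..n})"
    by (auto simp: partition_on_def disjoint_def)
  show "I \<in> (\<lambda>i. {i}) ` {1..n} \<Longrightarrow> \<exists>a b. I = {a..b}"
    using atLeastAtMost_singleton by blast
qed

text \<open>The partition into singletons shows that the minimum defining \<open>num_pieces\<close>
  is over a nonempty set.\<close>

lemma num_pieces_le: "num_pieces n u \<le> n"
  and num_pieces_partition: "\<exists>P. partition_on {1..n} P \<and> card P = num_pieces n u \<and>
     (\<forall>I\<in>P. (\<exists>a b. I = {a..b}) \<and> (\<forall>i\<in>I. \<forall>j\<in>I. u i = u j))"
proof -
  let ?Q = "\<lambda>k. \<exists>P. partition_on {1..n} P \<and> card P = k \<and>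
     (\<forall>I\<in>P. (\<exists>a b. I = {a..b}) \<and> (\<forall>i\<in>I. \<forall>j\<in>I. u i = u j))"
  have Q: "?Q n"
  proof (intro exI conjI)
    show "card ((\<lambda>i. {i}) ` {1..n}) = n"
      by (subst card_image) auto
    show "\<forall>I\<in>(\<lambda>i. {i}) ` {1..n}. (\<exists>a b. I = {a..b}) \<and> (\<forall>i\<in>I. \<forall>j\<in>I. u i = u j)"
      using singleton_partition(2) by fastforce
  qed (rule singleton_partition)
  show "num_pieces n u \<le> n"
    unfolding num_pieces_def by (rule Least_le) (rule Q)
  show "?Q (num_pieces n u)"
    unfolding num_pieces_def by (rule LeastI) (rule Q)
qed

text \<open>Concavity of the logarithm, in the form of its tangent at \<open>n / K\<close>. Having
  fewer than \<open>K\<close> pieces only helps, because \<open>ln (n / K)\<close> is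
  nonnegative.\<close>

lemma sum_ln_card_partition_le:
  assumes P: "partition_on {1..n} P" and "card P \<le> K" "1 \<le> K" "K \<le> n"
  shows "(\<Sum>I\<in>P. 1 + ln (real (card I))) \<le> real K * ln (exp 1 * real n / real K)"
proof -
  have finP: "finite P" using P finite_elements by blast
  have pos: "card I > 0" if "I \<in> P" for I
  proof -
    have "I \<noteq> {}" "I \<subseteq> {1..n}" using P that by (auto simp: partition_on_def)
    then show ?thesis by (meson card_gt_0_iff finite_atLeastAtMost finite_subset)
  qed
  have sum_card: "(\<Sum>I\<in>P. card I) = n"
    using product_partition[OF P] pos by (simp add: card_gt_0_iff)
  have nK: "real K > 0" "real n > 0" using assms by auto
  have "(\<Sum>I\<in>P. 1 + ln (real (card I))) \<le> (\<Sum>I\<in>P. ln (real n / real K) + real (card I) * (real K / real n))"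
  proof (rule sum_mono)
    fix I assume I: "I \<in> P"
    have "ln (real (card I) * real K / real n) \<le> real (card I) * real K / real n - 1"
      using pos[OF I] nK by (intro ln_le_minus_one) auto
    moreover have "ln (real (card I) * real K / real n) = ln (real (card I)) - ln (real n / real K)"
      using pos[OF I] nK by (simp add: ln_mult ln_div)
    ultimately show "1 + ln (real (card I)) \<le> ln (real n / real K) + real (card I) * (real K / real n)"
      by simp
  qed
  also have "\<dots> = real (card P) * ln (real n / real K) + real (\<Sum>I\<in>P. card I) * (real K / real n)"
    by (simp add: sum.distrib flip: sum_distrib_right sum_divide_distrib)
  also have "\<dots> \<le> real K * ln (real n / real K) + real K"
    unfolding sum_card using assms nK by (auto intro!: mult_right_mono)
  also have "\<dots> = real K * ln (exp 1 * real n / real K)"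
    using nK by (simp add: ln_mult ln_div algebra_simps)
  finally show ?thesis .
qed

subsection \<open>Oracle inequalities\<close>

text \<open>Serves the case \<open>k(u) = n\<close>, where \<open>k(u) + 1\<close> exceeds
  \<open>n\<close> and the concavity bound does not apply. The moment of \<open>n\<close> singletons
  is \<open>s ^ n\<close>, and \<open>n * ln s\<close> exceeds \<open>\<delta> * (s - 1)\<close> by
  at most the \<open>ln n\<close> that the deviation has to spare.\<close>

lemma singleton_partition_Chernoff:
  assumes "n \<ge> 2" "x > 0"
  defines "\<tau> \<equiv> sqrt (real (n + 1) * ln (exp 1 * real n / real (n + 1))) + sqrt (2 * (x + ln (real n)))"
  shows "\<exists>s>1. s ^ n * exp (- rate s * \<tau>\<^sup>2) \<le> exp (- x)"
proof -
  define \<delta> where "\<delta> = real (n + 1) * ln (exp 1 * real n / real (n + 1))"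
  define \<delta>\<^sub>0 where "\<delta>\<^sub>0 = real n - 1 / real n"
  have n: "real n \<ge> 2" using assms by simp
  have inv: "1 / real n \<le> 1 / 2" using n by (simp add: field_simps)
  have \<delta>\<^sub>0: "\<delta>\<^sub>0 \<ge> 3 / 2" using n inv unfolding \<delta>\<^sub>0_def by linarith
  \<comment> \<open>This makes \<open>n - 1 / n\<close> a rational lower bound of \<delta>.\<close>
  have "ln (real (n + 1) / real n) \<le> real (n + 1) / real n - 1"
    using n by (intro ln_le_minus_one) auto
  then have "ln (exp 1 * real n / real (n + 1)) \<ge> 1 - 1 / real n"
    using n by (simp add: ln_mult ln_div field_simps)
  then have "real (n + 1) * (1 - 1 / real n) \<le> \<delta>"
    unfolding \<delta>_def by (intro mult_left_mono) auto
  moreover have "real (n + 1) * (1 - 1 / real n) = \<delta>\<^sub>0"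
    using n by (simp add: \<delta>\<^sub>0_def field_simps)
  ultimately have \<delta>: "\<delta>\<^sub>0 \<le> \<delta>" by simp
  have "- ln (real n) \<le> 1 / real n - 1"
    using ln_le_minus_one[of "1 / real n"] n by (simp add: ln_div)
  with inv have ln_n: "ln (real n) \<ge> 1 / 2" by linarith
  define t where "t = x + ln (real n)"
  obtain s where s: "s > 1" "\<delta> * (s - 1) - rate s * \<tau>\<^sup>2 \<le> - t"
    using ex_Chernoff_parameter[of \<delta> t] \<delta> \<delta>\<^sub>0 ln_n assms(2) unfolding \<tau>_def \<delta>_def[symmetric] t_def
    by auto
  \<comment> \<open>Splitting off the ratio of \<open>\<delta>\<^sub>0\<close> and \<open>n\<close>
    makes \<open>\<delta>\<^sub>0 * (s - 1)\<close> the leading term and the error quadratic in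
    \<open>n - \<delta>\<^sub>0 = 1 / n\<close>.\<close>
  have "real n * ln s = real n * ln (s * \<delta>\<^sub>0 / real n) + real n * ln (real n / \<delta>\<^sub>0)"
    using n s \<delta>\<^sub>0 by (simp add: ln_mult ln_div algebra_simps)
  also have "\<dots> \<le> real n * (s * \<delta>\<^sub>0 / real n - 1) + real n * (real n / \<delta>\<^sub>0 - 1)"
    using n s \<delta>\<^sub>0 by (intro add_mono mult_left_mono ln_le_minus_one) auto
  also have "\<dots> = \<delta>\<^sub>0 * (s - 1) + (real n - \<delta>\<^sub>0)\<^sup>2 / \<delta>\<^sub>0"
    using n \<delta>\<^sub>0 by (simp add: field_simps power2_eq_square)
  also have "\<dots> \<le> \<delta> * (s - 1) + ln (real n)"
  proof (intro add_mono mult_right_mono)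
    have "real n - \<delta>\<^sub>0 = 1 / real n" by (simp add: \<delta>\<^sub>0_def)
    then have "(real n - \<delta>\<^sub>0)\<^sup>2 \<le> (1 / 2)\<^sup>2" using inv by (simp only:) (intro power_mono; simp)
    also have "\<dots> \<le> 1 / 2 * \<delta>\<^sub>0" using \<delta>\<^sub>0 by (simp add: power2_eq_square)
    finally have "(real n - \<delta>\<^sub>0)\<^sup>2 / \<delta>\<^sub>0 \<le> 1 / 2" using \<delta>\<^sub>0 by (simp add: field_simps)
    then show "(real n - \<delta>\<^sub>0)\<^sup>2 / \<delta>\<^sub>0 \<le> ln (real n)" using ln_n by linarith
  qed (use \<delta> s in auto)
  finally have "real n * ln s - rate s * \<tau>\<^sup>2 \<le> - x"
    using s(2) by (simp add: t_def)
  then have "exp (real n * ln s - rate s * \<tau>\<^sup>2) \<le> exp (- x)" by simp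
  moreover have "exp (real n * ln s - rate s * \<tau>\<^sup>2) = s ^ n * exp (- rate s * \<tau>\<^sup>2)"
    using s(1) by (simp add: exp_diff exp_minus exp_of_nat_mult divide_inverse)
  ultimately show ?thesis using s(1) by auto
qed

section \<open>Deviation bounds for unimodal sequences and the oracle inequality for a fixed
  \<open>u\<close>\<close>

context prob_space
begin

text \<open>Every vector is monotone on singletons, and each singleton contributes the moment
  \<open>s\<close>.\<close>

lemma gaussian_norm_deviation:
  fixes \<xi> :: "nat \<Rightarrow> 'a \<Rightarrow> real"
  assumes ind: "indep_vars (\<lambda>_. borel) \<xi> {1..n}"
    and normal: "\<And>i. i \<in> {1..n} \<Longrightarrow> distributed M lborel (\<xi> i) (normal_density 0 \<sigma>)"
    and "\<sigma> > 0" "s > 1" "\<tau> \<ge> 0"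
  shows "\<exists>E\<in>events. prob E \<ge> 1 - s ^ n * exp (- rate s * \<tau>\<^sup>2) \<and>
    (\<forall>\<omega>\<in>E. \<forall>v. (\<Sum>i=1..n. \<xi> i \<omega> * v i) \<le> \<sigma> * \<tau> * sqrt (\<Sum>i=1..n. (v i)\<^sup>2))"
proof -
  define P where "P = (\<lambda>i. {i}) ` {1..n}"
  have P: "partition_on {1..n} P" "\<And>I. I \<in> P \<Longrightarrow> \<exists>a b. I = {a..b}"
    unfolding P_def by (rule singleton_partition; assumption?)+
  have "(\<Prod>I\<in>P. \<Prod>i=1..card I. 1 + (s - 1) / real i) = s ^ n"
    unfolding P_def by (subst prod.reindex) auto
  with piecewise_monotone_deviation[where \<epsilon> = "\<lambda>_. 1" and P = P and s = s and \<tau> = \<tau>, OF ind normal P] assms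
  obtain E where E: "E \<in> events" "prob E \<ge> 1 - s ^ n * exp (- rate s * \<tau>\<^sup>2)"
    "\<forall>\<omega>\<in>E. \<forall>v. (\<forall>I\<in>P. mono_on I (\<lambda>i. 1 * v i)) \<longrightarrow>
      (\<Sum>i=1..n. \<xi> i \<omega> * v i) \<le> \<sigma> * \<tau> * sqrt (\<Sum>i=1..n. (v i)\<^sup>2)"
    by auto
  have "\<forall>I\<in>P. mono_on I (\<lambda>i. 1 * v i)" for v :: "nat \<Rightarrow> real"
    by (auto simp: P_def mono_on_def)
  with E show ?thesis by blast
qed

text \<open>By the harmonic bound for each piece and concavity over the pieces, the moments multiply
  to at most \<open>exp ((s - 1) * \<delta>)\<close>. The deviation \<tau> is the one for which the
  Chernoff parameter brings this down to \<open>exp (- t)\<close>.\<close>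

lemma partition_deviation:
  fixes \<xi> :: "nat \<Rightarrow> 'a \<Rightarrow> real" and \<epsilon> :: "nat set \<Rightarrow> real"
  assumes ind: "indep_vars (\<lambda>_. borel) \<xi> {1..n}"
    and normal: "\<And>i. i \<in> {1..n} \<Longrightarrow> distributed M lborel (\<xi> i) (normal_density 0 \<sigma>)"
    and P: "partition_on {1..n} P" "\<And>I. I \<in> P \<Longrightarrow> \<exists>a b. I = {a..b}"
    and \<epsilon>: "\<And>I. I \<in> P \<Longrightarrow> \<epsilon> I \<in> {1, - 1}"
    and "\<sigma> > 0" "t > 0" "card P \<le> K" "1 \<le> K" "K \<le> n"
  defines "\<tau> \<equiv> sqrt (real K * ln (exp 1 * real n / real K)) + sqrt (2 * t)"
  shows "\<exists>E\<in>events. prob E \<ge> 1 - exp (- t) \<and>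
    (\<forall>\<omega>\<in>E. \<forall>v. (\<forall>I\<in>P. mono_on I (\<lambda>i. \<epsilon> I * v i)) \<longrightarrow>
      (\<Sum>i=1..n. \<xi> i \<omega> * v i) \<le> \<sigma> * \<tau> * sqrt (\<Sum>i=1..n. (v i)\<^sup>2))"
proof -
  define \<delta> where "\<delta> = real K * ln (exp 1 * real n / real K)"
  have "1 \<le> real n / real K" using assms by simp
  then have "exp 1 * 1 \<le> exp 1 * (real n / real K)" by (intro mult_left_mono) auto
  moreover have "exp (1::real) > 1" by simp
  ultimately have "exp 1 * real n / real K > 1"
    unfolding mult_1_right times_divide_eq_right by linarith
  then have \<delta>: "\<delta> > 0" using assms by (simp add: \<delta>_def)
  obtain s where s: "s > 1" "\<delta> * (s - 1) - rate s * \<tau>\<^sup>2 \<le> - t"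
    using ex_Chernoff_parameter[OF \<delta> \<open>t > 0\<close>] unfolding \<tau>_def \<delta>_def by blast
  have card_pos: "card I \<ge> 1" if "I \<in> P" for I
  proof -
    have "I \<noteq> {}" "I \<subseteq> {1..n}" using P that by (auto simp: partition_on_def)
    then show ?thesis by (simp add: Suc_leI card_gt_0_iff finite_subset)
  qed
  have finP: "finite P" using P(1) finite_elements by blast
  have "(\<Prod>I\<in>P. \<Prod>i=1..card I. 1 + (s - 1) / real i) \<le> (\<Prod>I\<in>P. exp ((s - 1) * (1 + ln (real (card I)))))"
  proof (intro prod_mono conjI)
    fix I assume I: "I \<in> P"
    show "0 \<le> (\<Prod>i=1..card I. 1 + (s - 1) / real i)"
      using s by (intro prod_nonneg) auto
    show "(\<Prod>i=1..card I. 1 + (s - 1) / real i) \<le> exp ((s - 1) * (1 + ln (real (card I))))"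
      using s card_pos[OF I] by (intro prod_le_exp_ln) auto
  qed
  also have "\<dots> = exp ((s - 1) * (\<Sum>I\<in>P. 1 + ln (real (card I))))"
    using finP by (simp add: exp_sum sum_distrib_left)
  also have "\<dots> \<le> exp ((s - 1) * \<delta>)"
    using s sum_ln_card_partition_le[OF P(1) \<open>card P \<le> K\<close> \<open>1 \<le> K\<close> \<open>K \<le> n\<close>]
    by (simp add: \<delta>_def mult_left_mono)
  finally have "(\<Prod>I\<in>P. \<Prod>i=1..card I. 1 + (s - 1) / real i) * exp (- rate s * \<tau>\<^sup>2)
      \<le> exp ((s - 1) * \<delta>) * exp (- rate s * \<tau>\<^sup>2)"
    by (intro mult_right_mono) auto
  also have "\<dots> = exp (\<delta> * (s - 1) - rate s * \<tau>\<^sup>2)"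
    by (simp add: mult.commute flip: exp_add)
  also have "\<dots> \<le> exp (- t)" using s by simp
  finally have le: "1 - exp (- t)
      \<le> 1 - (\<Prod>I\<in>P. \<Prod>i=1..card I. 1 + (s - 1) / real i) * exp (- rate s * \<tau>\<^sup>2)"
    by simp
  have "\<tau> \<ge> 0" using \<delta> \<open>t > 0\<close> unfolding \<tau>_def \<delta>_def by (intro add_nonneg_nonneg) auto
  from piecewise_monotone_deviation[where \<epsilon> = \<epsilon> and P = P, OF ind normal P \<epsilon> \<open>\<sigma> > 0\<close> s(1) this]
  obtain E where "E \<in> events"
    "prob E \<ge> 1 - (\<Prod>I\<in>P. \<Prod>i=1..card I. 1 + (s - 1) / real i) * exp (- rate s * \<tau>\<^sup>2)"
    "\<forall>\<omega>\<in>E. \<forall>v. (\<forall>I\<in>P. mono_on I (\<lambda>i. \<epsilon> I * v i)) \<longrightarrow>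
      (\<Sum>i=1..n. \<xi> i \<omega> * v i) \<le> \<sigma> * \<tau> * sqrt (\<Sum>i=1..n. (v i)\<^sup>2)"
    by blast
  with le show ?thesis by (intro bexI[of _ E]) linarith+
qed

text \<open>A union bound over the \<open>n\<close> possible modes, each failing with probability at
  most \<open>exp (- x) / n\<close>. As \<open>u\<close> is constant on its pieces,
  \<open>w - u\<close> inherits the monotonicity of \<open>w\<close> on the cut pieces;
  \<open>k(u) < n\<close> keeps their number at most \<open>n\<close>.\<close>

lemma unimodal_deviation:
  fixes \<xi> :: "nat \<Rightarrow> 'a \<Rightarrow> real"
  assumes ind: "indep_vars (\<lambda>_. borel) \<xi> {1..n}"
    and normal: "\<And>i. i \<in> {1..n} \<Longrightarrow> distributed M lborel (\<xi> i) (normal_density 0 \<sigma>)"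
    and "\<sigma> > 0" "x > 0" "num_pieces n u < n"
  defines "\<tau> \<equiv> sqrt (real (num_pieces n u + 1) * ln (exp 1 * real n / real (num_pieces n u + 1)))
            + sqrt (2 * (x + ln (real n)))"
  shows "\<exists>E\<in>events. prob E \<ge> 1 - exp (- x) \<and>
    (\<forall>\<omega>\<in>E. \<forall>w\<in>unimodal n.
      (\<Sum>i=1..n. \<xi> i \<omega> * (w i - u i)) \<le> \<sigma> * \<tau> * sqrt (\<Sum>i=1..n. (w i - u i)\<^sup>2))"
proof -
  define t where "t = x + ln (real n)"
  have n: "n \<ge> 1" using assms by simp
  have t: "t > 0" using \<open>x > 0\<close> n by (simp add: t_def add_pos_nonneg)
  obtain P where P: "partition_on {1..n} P" "card P = num_pieces n u"
    and pieces: "\<forall>I\<in>P. (\<exists>a b. I = {a..b}) \<and> (\<forall>i\<in>I. \<forall>j\<in>I. u i = u j)"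
    using num_pieces_partition[of n u] by (elim exE conjE)
  have P_int: "\<forall>I\<in>P. \<exists>a b. I = {a..b}"
    using pieces by simp
  have "\<exists>E\<in>events. prob E \<ge> 1 - exp (- t) \<and>
    (\<forall>\<omega>\<in>E. \<forall>w\<in>unimodal_cone n m.
      (\<Sum>i=1..n. \<xi> i \<omega> * (w i - u i)) \<le> \<sigma> * \<tau> * sqrt (\<Sum>i=1..n. (w i - u i)\<^sup>2))"
    if m: "m \<in> {1..n}" for m
  proof -
    obtain P' where P': "partition_on {1..n} P'" "card P' \<le> card P + 1"
      and pieces': "\<forall>I\<in>P'. (\<exists>a b. I = {a..b}) \<and> (\<exists>J\<in>P. I \<subseteq> J) \<and> (I \<subseteq> {1..m} \<or> I \<subseteq> {m..n})"
      using split_interval_partition[OF P(1) P_int m] by (elim exE conjE)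
    have P'_int: "\<exists>a b. I = {a..b}" if "I \<in> P'" for I
      using pieces' that by simp
    \<comment> \<open>The sign turns the decreasing branch into an increasing one; on a piece
      \<open>{m}\<close>, which lies in both branches, either sign works.\<close>
    define \<epsilon> :: "nat set \<Rightarrow> real" where "\<epsilon> I = (if I \<subseteq> {1..m} then - 1 else 1)" for I
    have mono: "mono_on I (\<lambda>i. \<epsilon> I * (w i - u i))" if w: "w \<in> unimodal_cone n m" and I: "I \<in> P'" for w I
    proof -
      have anti: "w j \<le> w i" if "i \<in> {1..m}" "j \<in> {1..m}" "i \<le> j" for i j
        using w that by (auto simp: unimodal_cone_def monotone_on_def)
      have incr: "w i \<le> w j" if "i \<in> {m..n}" "j \<in> {m..n}" "i \<le> j" for i j
        using w that by (auto simp: unimodal_cone_def monotone_on_def)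
      obtain J where J: "J \<in> P" "I \<subseteq> J" using bspec[OF pieces' I] by blast
      have const: "u i = u j" if "i \<in> I" "j \<in> I" for i j
        using bspec[OF pieces J(1)] J(2) that by blast
      show ?thesis
      proof (rule mono_onI)
        fix i j assume ij: "i \<in> I" "j \<in> I" "i \<le> j"
        show "\<epsilon> I * (w i - u i) \<le> \<epsilon> I * (w j - u j)"
        proof (cases "I \<subseteq> {1..m}")
          case True
          then have "i \<in> {1..m}" "j \<in> {1..m}" using ij by blast+
          from anti[OF this ij(3)] True const[OF ij(1,2)] show ?thesis by (simp add: \<epsilon>_def)
        next
          case False
          then have "I \<subseteq> {m..n}" using bspec[OF pieces' I] by blast
          then have "i \<in> {m..n}" "j \<in> {m..n}" using ij by blast+
          from incr[OF this ij(3)] False const[OF ij(1,2)] show ?thesis by (simp add: \<epsilon>_def)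
        qed
      qed
    qed
    have "\<exists>E\<in>events. prob E \<ge> 1 - exp (- t) \<and>
      (\<forall>\<omega>\<in>E. \<forall>v. (\<forall>I\<in>P'. mono_on I (\<lambda>i. \<epsilon> I * v i)) \<longrightarrow>
        (\<Sum>i=1..n. \<xi> i \<omega> * v i) \<le> \<sigma> * \<tau> * sqrt (\<Sum>i=1..n. (v i)\<^sup>2))"
      unfolding \<tau>_def t_def[symmetric]
    proof (rule partition_deviation[OF ind normal P'(1) P'_int])
      show "\<epsilon> I \<in> {1, - 1}" for I by (simp add: \<epsilon>_def)
      show "card P' \<le> num_pieces n u + 1" using P'(2) P(2) by simp
    qed (use assms(3,5) t in auto)
    then obtain E where E: "E \<in> events" "prob E \<ge> 1 - exp (- t)"
      and dev: "\<forall>\<omega>\<in>E. \<forall>v. (\<forall>I\<in>P'. mono_on I (\<lambda>i. \<epsilon> I * v i)) \<longrightarrow>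
        (\<Sum>i=1..n. \<xi> i \<omega> * v i) \<le> \<sigma> * \<tau> * sqrt (\<Sum>i=1..n. (v i)\<^sup>2)"
      by (elim bexE conjE)
    have "(\<Sum>i=1..n. \<xi> i \<omega> * (w i - u i)) \<le> \<sigma> * \<tau> * sqrt (\<Sum>i=1..n. (w i - u i)\<^sup>2)"
      if "\<omega> \<in> E" "w \<in> unimodal_cone n m" for \<omega> w
      using dev[rule_format, OF that(1), of "\<lambda>i. w i - u i"] mono[OF that(2)] by simp
    with E show ?thesis by blast
  qed
  then have "\<forall>m\<in>{1..n}. \<exists>E. E \<in> events \<and> prob E \<ge> 1 - exp (- t) \<and>
    (\<forall>\<omega>\<in>E. \<forall>w\<in>unimodal_cone n m.
      (\<Sum>i=1..n. \<xi> i \<omega> * (w i - u i)) \<le> \<sigma> * \<tau> * sqrt (\<Sum>i=1..n. (w i - u i)\<^sup>2))"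
    by (simp only: Bex_def Ball_def) blast
  from bchoice[OF this] obtain E where *: "\<forall>m\<in>{1..n}. E m \<in> events \<and> prob (E m) \<ge> 1 - exp (- t) \<and>
    (\<forall>\<omega>\<in>E m. \<forall>w\<in>unimodal_cone n m.
      (\<Sum>i=1..n. \<xi> i \<omega> * (w i - u i)) \<le> \<sigma> * \<tau> * sqrt (\<Sum>i=1..n. (w i - u i)\<^sup>2))"
    by (elim exE)
  have E: "E m \<in> events" "prob (E m) \<ge> 1 - exp (- t)"
    and bound: "\<forall>\<omega>\<in>E m. \<forall>w\<in>unimodal_cone n m.
      (\<Sum>i=1..n. \<xi> i \<omega> * (w i - u i)) \<le> \<sigma> * \<tau> * sqrt (\<Sum>i=1..n. (w i - u i)\<^sup>2)"
    if "m \<in> {1..n}" for m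
    using bspec[OF * that] by simp_all
  define F where "F = (\<Union>m\<in>{1..n}. space M - E m)"
  have F: "F \<in> events" unfolding F_def using E(1) by (intro sets.finite_UN) auto
  have "prob F \<le> (\<Sum>m\<in>{1..n}. prob (space M - E m))"
    unfolding F_def using E(1) by (intro finite_measure_subadditive_finite) auto
  also have "\<dots> \<le> (\<Sum>m\<in>{1..n}. exp (- t))"
  proof (rule sum_mono)
    fix m assume "m \<in> {1..n}"
    from E[OF this] show "prob (space M - E m) \<le> exp (- t)" by (simp add: prob_compl)
  qed
  also have "\<dots> = exp (- x)"
    using n by (simp add: t_def exp_minus exp_diff divide_inverse)
  finally have "prob (space M - F) \<ge> 1 - exp (- x)"
    using prob_compl[OF F] by simp
  moreover have "(\<Sum>i=1..n. \<xi> i \<omega> * (w i - u i)) \<le> \<sigma> * \<tau> * sqrt (\<Sum>i=1..n. (w i - u i)\<^sup>2)"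
    if \<omega>: "\<omega> \<in> space M - F" and w: "w \<in> unimodal n" for \<omega> w
  proof -
    obtain m where m: "m \<in> {1..n}" "w \<in> unimodal_cone n m"
      using w by (auto simp: unimodal_def)
    with \<omega> have "\<omega> \<in> E m" by (auto simp: F_def)
    with bound[OF m(1)] m(2) show ?thesis by blast
  qed
  ultimately show ?thesis
    using F by (intro bexI[of _ "space M - F"]) blast+
qed

text \<open>For \<open>n = 1\<close> all sequences are unimodal, so the estimator reproduces
  \<open>y\<close> and its error is exactly the noise. The factor 2 of the basic inequality is thus
  free to enlarge the deviation, which compensates for \<open>2 * ln (e / 2) < 1\<close>.\<close>

lemma unimodal_least_squares_single_observation:
  fixes \<mu> :: "nat \<Rightarrow> real" and \<xi> :: "nat \<Rightarrow> 'a \<Rightarrow> real" and y \<mu>hat :: "'a \<Rightarrow> nat \<Rightarrow> real"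
  assumes ind: "indep_vars (\<lambda>_. borel) \<xi> {1..1}"
    and normal: "\<And>i. i \<in> {1..1} \<Longrightarrow> distributed M lborel (\<xi> i) (normal_density 0 \<sigma>)"
    and y: "\<And>\<omega>. \<omega> \<in> space M \<Longrightarrow> y \<omega> 1 = \<mu> 1 + \<xi> 1 \<omega>"
    and LS: "\<And>\<omega>. \<omega> \<in> space M \<Longrightarrow> is_least_squares 1 (unimodal 1) (y \<omega>) (\<mu>hat \<omega>)"
    and "\<sigma> > 0" "x > 0"
  shows "\<exists>E\<in>events. prob E \<ge> 1 - exp (- x) \<and>
    (\<forall>\<omega>\<in>E. scaled_norm 1 (\<lambda>i. \<mu>hat \<omega> i - \<mu> i) \<le> 2 * \<sigma> * (sqrt (2 * ln (exp 1 / 2)) + sqrt (2 * x)))"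
proof -
  define \<tau> where "\<tau> = 2 * (sqrt (2 * ln (exp 1 / 2)) + sqrt (2 * x))"
  define \<delta> :: real where "\<delta> = 2 * ln (exp 1 / 2)"
  have \<delta>: "\<delta> \<ge> 1 / 2"
    using ln2_le_25_over_36 by (simp add: \<delta>_def ln_div)
  have \<tau>: "\<tau> = 2 * (sqrt \<delta> + sqrt (2 * x))" by (simp add: \<tau>_def \<delta>_def)
  have \<tau>_nonneg: "\<tau> \<ge> 0" using \<delta> \<open>x > 0\<close> by (simp add: \<tau>)
  define q where "q = sqrt \<delta> * sqrt (2 * x)"
  have "\<tau>\<^sup>2 = 4 * ((sqrt \<delta>)\<^sup>2 + (sqrt (2 * x))\<^sup>2 + 2 * q)"
    by (simp only: \<tau> q_def) (simp add: power2_eq_square algebra_simps)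
  then have "\<tau>\<^sup>2 = 4 * \<delta> + 8 * x + 8 * q"
    using \<delta> \<open>x > 0\<close> by simp
  moreover have "q \<ge> 0" using \<delta> \<open>x > 0\<close> by (simp add: q_def)
  ultimately have \<tau>2: "\<tau>\<^sup>2 \<ge> 2 + 8 * x" using \<delta> by linarith
  \<comment> \<open>The fixed parameter \<open>s = sqrt 2\<close> is enough: its moment is at most
    \<open>exp (1 / 2)\<close>, and \<open>\<tau>\<^sup>2 / 4 \<ge> 1 / 2 + 2 * x\<close>.\<close>
  have rate: "rate (sqrt 2) = 1 / 4" by (simp add: rate_def)
  have "sqrt 2 \<le> (3 / 2 :: real)" by (rule real_le_lsqrt) (simp_all add: power2_eq_square)
  also have "\<dots> \<le> exp (1 / 2)" using exp_ge_add_one_self[of "1 / 2 :: real"] by simp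
  finally have "sqrt 2 * exp (- rate (sqrt 2) * \<tau>\<^sup>2) \<le> exp (1 / 2) * exp (- (1 / 2 + 2 * x))"
    using \<tau>2 by (intro mult_mono) (auto simp: rate)
  also have "\<dots> \<le> exp (- x)" using \<open>x > 0\<close> by (simp flip: exp_add)
  finally have le: "1 - exp (- x) \<le> 1 - sqrt 2 ^ 1 * exp (- rate (sqrt 2) * \<tau>\<^sup>2)" by simp
  obtain E where E: "E \<in> events" "prob E \<ge> 1 - exp (- x)"
    "\<forall>\<omega>\<in>E. \<forall>v. (\<Sum>i=1..1. \<xi> i \<omega> * v i) \<le> \<sigma> * \<tau> * sqrt (\<Sum>i=1..1. (v i)\<^sup>2)"
    using gaussian_norm_deviation[OF ind normal \<open>\<sigma> > 0\<close> _ \<tau>_nonneg, of "sqrt 2"] le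
    by (auto intro: order_trans)
  have "scaled_norm 1 (\<lambda>i. \<mu>hat \<omega> i - \<mu> i) \<le> \<sigma> * \<tau>" if "\<omega> \<in> E" for \<omega>
  proof -
    have \<omega>: "\<omega> \<in> space M" using that E(1) sets.sets_into_space by blast
    have "y \<omega> \<in> unimodal 1"
      by (auto simp: unimodal_def unimodal_cone_def monotone_on_def)
    with LS[OF \<omega>] have "\<not> (scaled_norm 1 (\<lambda>i. y \<omega> i - y \<omega> i))\<^sup>2 < (scaled_norm 1 (\<lambda>i. y \<omega> i - \<mu>hat \<omega> i))\<^sup>2"
      unfolding is_least_squares_def is_arg_min_def by blast
    then have "\<mu>hat \<omega> 1 = y \<omega> 1" by (simp add: scaled_norm_def)
    then have norm: "scaled_norm 1 (\<lambda>i. \<mu>hat \<omega> i - \<mu> i) = \<bar>\<xi> 1 \<omega>\<bar>"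
      using y[OF \<omega>] by (simp add: scaled_norm_def)
    \<comment> \<open>The deviation bound is tested with the noise itself as
      \<open>v\<close>.\<close>
    have "\<xi> 1 \<omega> * \<xi> 1 \<omega> \<le> \<sigma> * \<tau> * \<bar>\<xi> 1 \<omega>\<bar>"
      using E(3)[rule_format, OF that, of "\<lambda>i. \<xi> i \<omega>"] by simp
    then have "\<bar>\<xi> 1 \<omega>\<bar> * \<bar>\<xi> 1 \<omega>\<bar> \<le> \<sigma> * \<tau> * \<bar>\<xi> 1 \<omega>\<bar>" by simp
    then have "\<bar>\<xi> 1 \<omega>\<bar> \<le> \<sigma> * \<tau>"
      using \<tau>_nonneg \<open>\<sigma> > 0\<close> by (cases "\<xi> 1 \<omega> = 0") (auto dest: mult_right_le_imp_le simp del: abs_mult_self_eq)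
    then show ?thesis by (simp only: norm)
  qed
  then show ?thesis
    using E(1,2) by (intro bexI[of _ E]) (auto simp: \<tau>_def algebra_simps)
qed

lemma unimodal_oracle_inequality:
  fixes \<mu> :: "nat \<Rightarrow> real" and \<xi> :: "nat \<Rightarrow> 'a \<Rightarrow> real" and y \<mu>hat :: "'a \<Rightarrow> nat \<Rightarrow> real"
  assumes "n \<ge> 1" "\<sigma> > 0" and ind: "indep_vars (\<lambda>_. borel) \<xi> {1..n}"
    and normal: "\<And>i. i \<in> {1..n} \<Longrightarrow> distributed M lborel (\<xi> i) (normal_density 0 \<sigma>)"
    and y: "\<And>\<omega> i. \<omega> \<in> space M \<Longrightarrow> i \<in> {1..n} \<Longrightarrow> y \<omega> i = \<mu> i + \<xi> i \<omega>"
    and LS: "\<And>\<omega>. \<omega> \<in> space M \<Longrightarrow> is_least_squares n (unimodal n) (y \<omega>) (\<mu>hat \<omega>)"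
    and "x > 0" and u: "u \<in> unimodal n"
  shows "\<exists>E\<in>events. prob E \<ge> 1 - exp (- x) \<and>
    (\<forall>\<omega>\<in>E. scaled_norm n (\<lambda>i. \<mu>hat \<omega> i - \<mu> i) \<le>
      scaled_norm n (\<lambda>i. u i - \<mu> i) +
         2 * \<sigma> / sqrt (real n) *
           (sqrt (real (num_pieces n u + 1) * ln (exp 1 * real n / real (num_pieces n u + 1)))
            + sqrt (2 * (x + ln (real n)))))"
proof -
  define \<tau> where "\<tau> = sqrt (real (num_pieces n u + 1) * ln (exp 1 * real n / real (num_pieces n u + 1)))
            + sqrt (2 * (x + ln (real n)))"
  have num: "num_pieces n u \<le> n" by (rule num_pieces_le)
  \<comment> \<open>The chain \<open>k(u) + 1 \<le> 2 * n \<le> e * n\<close> keeps the logarithm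
    nonnegative even for \<open>k(u) = n\<close>.\<close>
  have "exp 1 * real n \<ge> 2 * real n"
    using exp_ge_add_one_self[of "1::real"] by (intro mult_right_mono) auto
  moreover have "real (num_pieces n u + 1) \<le> 2 * real n"
    using num \<open>n \<ge> 1\<close> by simp
  ultimately have "real (num_pieces n u + 1) \<le> exp 1 * real n" by linarith
  then have "ln (exp 1 * real n / real (num_pieces n u + 1)) \<ge> 0"
    by (intro ln_ge_zero) (simp add: field_simps)
  moreover have "x + ln (real n) \<ge> 0" using assms by simp
  ultimately have \<tau>_nonneg: "\<tau> \<ge> 0" unfolding \<tau>_def by (intro add_nonneg_nonneg) auto
  \<comment> \<open>The uniform deviation bound comes from the union over modes if
    \<open>k(u) < n\<close>, and from the norm of the whole noise if
    \<open>k(u) = n \<ge> 2\<close>.\<close>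
  consider "n = 1" "num_pieces n u = n"
    | (dev) "\<exists>E\<in>events. prob E \<ge> 1 - exp (- x) \<and> (\<forall>\<omega>\<in>E. \<forall>w\<in>unimodal n.
        (\<Sum>i=1..n. \<xi> i \<omega> * (w i - u i)) \<le> \<sigma> * \<tau> * sqrt (\<Sum>i=1..n. (w i - u i)\<^sup>2))"
  proof (cases "num_pieces n u < n")
    case True
    then show ?thesis
      using that(2) unimodal_deviation[OF ind normal \<open>\<sigma> > 0\<close> \<open>x > 0\<close>, of u] unfolding \<tau>_def by blast
  next
    case False
    then have eq: "num_pieces n u = n" using num by simp
    show ?thesis
    proof (cases "n = 1")
      case False
      then obtain s where s: "s > 1" "s ^ n * exp (- rate s * \<tau>\<^sup>2) \<le> exp (- x)"
        using singleton_partition_Chernoff[of n x] assms(1,7) unfolding \<tau>_def eq by auto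
      obtain E where "E \<in> events" "prob E \<ge> 1 - s ^ n * exp (- rate s * \<tau>\<^sup>2)"
        "\<forall>\<omega>\<in>E. \<forall>v. (\<Sum>i=1..n. \<xi> i \<omega> * v i) \<le> \<sigma> * \<tau> * sqrt (\<Sum>i=1..n. (v i)\<^sup>2)"
        using gaussian_norm_deviation[OF ind normal \<open>\<sigma> > 0\<close> s(1) \<tau>_nonneg] by auto
      then show ?thesis
        using that(2) s(2) by (intro that(2) bexI[of _ E]) auto
    qed (use that(1) eq in blast)
  qed
  then show ?thesis
  proof cases
    case 1
    have n1: "n = 1" and k1: "num_pieces 1 u = 1" using 1 by auto
    have "0 \<le> scaled_norm n (\<lambda>i. u i - \<mu> i)" by (simp add: scaled_norm_def sum_nonneg)
    moreover obtain E where "E \<in> events" "prob E \<ge> 1 - exp (- x)"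
      "\<forall>\<omega>\<in>E. scaled_norm 1 (\<lambda>i. \<mu>hat \<omega> i - \<mu> i) \<le> 2 * \<sigma> * (sqrt (2 * ln (exp 1 / 2)) + sqrt (2 * x))"
      using unimodal_least_squares_single_observation[where \<mu>hat = \<mu>hat and y = y and \<mu> = \<mu>, OF
          ind[unfolded n1] normal[unfolded n1] y[unfolded n1] LS[unfolded n1] \<open>\<sigma> > 0\<close> \<open>x > 0\<close>]
      by auto
    ultimately show ?thesis
      unfolding n1 k1 by (intro bexI[of _ E]) (auto simp: add_increasing)
  next
    case dev
    then obtain E where E: "E \<in> events" "prob E \<ge> 1 - exp (- x)"
      "\<And>\<omega> w. \<omega> \<in> E \<Longrightarrow> w \<in> unimodal n \<Longrightarrow>
        (\<Sum>i=1..n. \<xi> i \<omega> * (w i - u i)) \<le> \<sigma> * \<tau> * sqrt (\<Sum>i=1..n. (w i - u i)\<^sup>2)"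
      by blast
    have "scaled_norm n (\<lambda>i. \<mu>hat \<omega> i - \<mu> i) \<le> scaled_norm n (\<lambda>i. u i - \<mu> i) + 2 * (\<sigma> * \<tau>) / sqrt (real n)"
      if "\<omega> \<in> E" for \<omega>
    proof -
      have \<omega>: "\<omega> \<in> space M" using that E(1) sets.sets_into_space by blast
      have "\<mu>hat \<omega> \<in> unimodal n"
        using LS[OF \<omega>] by (simp add: is_least_squares_def is_arg_min_def)
      from E(3)[OF that this] show ?thesis
        using \<tau>_nonneg \<open>\<sigma> > 0\<close> \<open>n \<ge> 1\<close> y[OF \<omega>] LS[OF \<omega>] u
        by (intro least_squares_deviation[where z = "\<lambda>i. \<xi> i \<omega>" and y = "y \<omega>" and K = "unimodal n"]) auto
    qed
    then show ?thesis
      using E(1,2) unfolding \<tau>_def[symmetric] by (intro bexI[of _ E]) (auto simp: mult.assoc)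
  qed
qed

text \<open>Each tail union contains one of the events and so has probability at least
  \<open>p\<close>; the tail unions decrease to the intersection.\<close>

lemma limsup_events:
  assumes E: "\<And>j. E j \<in> events" "\<And>j::nat. prob (E j) \<ge> p"
  shows "prob (\<Inter>k. \<Union>j\<in>{k..}. E j) \<ge> p"
proof -
  have lim: "(\<lambda>k. prob (\<Union>j\<in>{k..}. E j)) \<longlonglongrightarrow> prob (\<Inter>k. \<Union>j\<in>{k..}. E j)"
  proof (rule finite_Lim_measure_decseq)
    show "range (\<lambda>k. \<Union>j\<in>{k..}. E j) \<subseteq> events" using E(1) by auto
    show "decseq (\<lambda>k. \<Union>j\<in>{k..}. E j)" unfolding decseq_def by (intro allI impI UN_mono) auto
  qed
  have "p \<le> prob (\<Union>j\<in>{k..}. E j)" for k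
  proof -
    have "(\<Union>j\<in>{k..}. E j) \<in> events" using E(1) by (intro sets.countable_UN') auto
    moreover have "E k \<subseteq> (\<Union>j\<in>{k..}. E j)" by (rule UN_upper) simp
    ultimately have "prob (E k) \<le> prob (\<Union>j\<in>{k..}. E j)" by (intro finite_measure_mono)
    with E(2)[of k] show ?thesis by linarith
  qed
  then have "\<exists>N. \<forall>k\<ge>N. p \<le> prob (\<Union>j\<in>{k..}. E j)" by blast
  with lim show ?thesis by (rule LIMSEQ_le_const)
qed

end

theorem theoremA4:
  fixes M :: "'a measure" and n :: nat and \<mu> :: "nat \<Rightarrow> real" and \<sigma> x :: real
    and \<xi> :: "nat \<Rightarrow> 'a \<Rightarrow> real" and y \<mu>hat :: "'a \<Rightarrow> nat \<Rightarrow> real"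
  assumes "prob_space M" and "n \<ge> 1" and "\<sigma> > 0"
    and "prob_space.indep_vars M (\<lambda>_. borel) \<xi> {1..n}"
    and "\<And>i. i \<in> {1..n} \<Longrightarrow> distributed M lborel (\<xi> i) (normal_density 0 \<sigma>)"
    and "\<And>\<omega> i. \<omega> \<in> space M \<Longrightarrow> i \<in> {1..n} \<Longrightarrow> y \<omega> i = \<mu> i + \<xi> i \<omega>"
    and "\<And>\<omega>. \<omega> \<in> space M \<Longrightarrow> is_least_squares n (unimodal n) (y \<omega>) (\<mu>hat \<omega>)"
    and "x > 0"
  shows "\<exists>E\<in>sets M. measure M E \<ge> 1 - exp (- x) \<and>
    (\<forall>\<omega>\<in>E. scaled_norm n (\<lambda>i. \<mu>hat \<omega> i - \<mu> i) \<le>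
      (INF u\<in>unimodal n. scaled_norm n (\<lambda>i. u i - \<mu> i) +
         2 * \<sigma> / sqrt (real n) *
           (sqrt (real (num_pieces n u + 1) * ln (exp 1 * real n / real (num_pieces n u + 1)))
            + sqrt (2 * (x + ln (real n))))))"
proof -
  interpret prob_space M by fact
  define r where "r u = scaled_norm n (\<lambda>i. u i - \<mu> i) +
         2 * \<sigma> / sqrt (real n) *
           (sqrt (real (num_pieces n u + 1) * ln (exp 1 * real n / real (num_pieces n u + 1)))
            + sqrt (2 * (x + ln (real n))))" for u
  define a where "a = (INF u\<in>unimodal n. r u)"
  have ne: "unimodal n \<noteq> {}"
  proof -
    have "(\<lambda>_. 0) \<in> unimodal n"
      using assms(2) by (auto simp: unimodal_def unimodal_cone_def monotone_on_def)
    then show ?thesis by blast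
  qed
  \<comment> \<open>Each \<open>u\<close> has its own event, and intersecting these events would
    lose probability. A minimising sequence is taken instead, and its events are combined by their
    limes superior.\<close>
  have "\<exists>u\<in>unimodal n. r u < a + 1 / real (Suc j)" for j
  proof -
    have "Inf (r ` unimodal n) < a + 1 / real (Suc j)" by (simp add: a_def)
    from cInf_lessD[OF _ this] ne show ?thesis by auto
  qed
  then obtain u where u: "\<And>j. u j \<in> unimodal n" "\<And>j. r (u j) < a + 1 / real (Suc j)" by metis
  have "\<exists>E\<in>events. prob E \<ge> 1 - exp (- x) \<and>
      (\<forall>\<omega>\<in>E. scaled_norm n (\<lambda>i. \<mu>hat \<omega> i - \<mu> i) \<le> r (u j))" for j
    unfolding r_def by (rule unimodal_oracle_inequality[OF assms(2-8) u(1)])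
  then have "\<forall>j. \<exists>E. E \<in> events \<and> prob E \<ge> 1 - exp (- x) \<and>
      (\<forall>\<omega>\<in>E. scaled_norm n (\<lambda>i. \<mu>hat \<omega> i - \<mu> i) \<le> r (u j))"
    unfolding Bex_def by (rule allI)
  from choice[OF this] obtain E where *: "\<forall>j. E j \<in> events \<and> prob (E j) \<ge> 1 - exp (- x) \<and>
      (\<forall>\<omega>\<in>E j. scaled_norm n (\<lambda>i. \<mu>hat \<omega> i - \<mu> i) \<le> r (u j))"
    by (elim exE)
  then have E: "\<And>j. E j \<in> events" "\<And>j. prob (E j) \<ge> 1 - exp (- x)"
    and bound: "\<And>j. \<forall>\<omega>\<in>E j. scaled_norm n (\<lambda>i. \<mu>hat \<omega> i - \<mu> i) \<le> r (u j)"
    by simp_all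
  \<comment> \<open>A point of the limes superior lies in \<open>E j\<close> for arbitrarily large
    \<open>j\<close>, where the bound is below \<open>a + 1 / (j + 1)\<close>.\<close>
  have "scaled_norm n (\<lambda>i. \<mu>hat \<omega> i - \<mu> i) \<le> a" if "\<omega> \<in> (\<Inter>k. \<Union>j\<in>{k..}. E j)" for \<omega>
  proof (rule field_le_epsilon)
    fix e :: real assume "e > 0"
    then obtain k where k: "1 / real (Suc k) < e"
      using reals_Archimedean[of e] by (auto simp: inverse_eq_divide)
    have "\<omega> \<in> (\<Union>j\<in>{k..}. E j)" using that by (rule INT_D) simp
    then obtain j where j: "j \<ge> k" "\<omega> \<in> E j" by auto
    have "1 / real (Suc j) \<le> 1 / real (Suc k)" using j(1) by (simp add: field_simps)
    with bspec[OF bound j(2)] u(2)[of j] k show "scaled_norm n (\<lambda>i. \<mu>hat \<omega> i - \<mu> i) \<le> a + e"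
      by linarith
  qed
  moreover have "(\<Inter>k. \<Union>j\<in>{k..}. E j) \<in> events" using E(1) by auto
  moreover have "prob (\<Inter>k. \<Union>j\<in>{k..}. E j) \<ge> 1 - exp (- x)"
    using E by (rule limsup_events)
  ultimately show ?thesis
    unfolding a_def r_def by blast
qed

end
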